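(* Let $R$ be an associative ring with non-zero identity element such that the factor ring $R/P(R)$ is indecomposable and satisfies the $(n,m)$-condition. Let $n\ge 2$ and let $K_1$, $K_2$ be $(01)$-formal matrix rings of order $n$ over $R$ with principal multiplier matrices $S$ and $T$, respectively. Then the following assertions hold. 1. If the rings $K_1$ and $K_2$ are isomorphic, then the matrices $S$ and $T$ have the same canonical forms. 2. If $K_1$ and $K_2$ are $(01)$-formal matrix rings of the form $K_0$ and the canonical forms of the matrices $S$ and $T$ coincide, then the rings $K_1$ and $K_2$ are isomorphic.
   Context: $P(A)$ denotes the prime radical of a ring $A$. A ring is indecomposable if $0$ and $1$ are its only central idempotents. A ring $A$ satisfies the $(n,m)$-condition if for any positive integers $n,m$, an isomorphism of the ordinary matrix rings $M(n,A)\cong M(m,A)$ implies $n=m$. Formal matrix rings over $R$. Let $\Sigma=\{s_{ijk}\mid i,j,k=1,\ldots,n\}$ be a set of central elements of $R$ such that $s_{iik}=1=s_{ikk}$ and $s_{ijk}s_{ik\ell}=s_{ij\ell}s_{jk\ell}$ for all $i,j,k,\ell\in\{1,\ldots,n\}$. The ring $M(n,R,\Sigma)$ is the set of all $n\times n$ matrices over $R$ with entrywise addition and with multiplication $(a_{ij})(b_{ij})=(c_{ij})$, where $c_{ij}=\sum_{k=1}^n s_{ikj}a_{ik}b_{kj}$. It is called a formal matrix ring (of order $n$) over $R$; the $s_{ijk}$ are its multipliers. Its principal multiplier matrix is the $n\times n$ matrix $(s_{iji})$, whose $(i,j)$ entry is $s_{iji}$. A $(01)$-formal matrix ring is a ring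 $M(n,R,\Sigma)$ in which every multiplier $s_{ijk}$ equals $0$ or $1$. Such a ring is of the form $K_0$ if $s_{ijk}=0$ for any pairwise distinct $i,j,k$ such that $s_{iji}=0=s_{jkj}$. Canonical form. For a permutation $\sigma$ of $\{1,\ldots,n\}$ and a matrix $A=(a_{ij})$, put $\sigma A=(a_{\sigma(i)\sigma(j)})$. A matrix is of canonical form if it can be represented in a block form with square blocks consisting entirely of $1$'s along the main diagonal and zeros in all other positions. For the principal multiplier matrix $S$ of any $(01)$-formal matrix ring there is a permutation $\sigma$ such that $\sigma S$ is of canonical form; $\sigma S$ is called the canonical form of $S$. It is determined up to a permutation of the blocks on the main diagonal (and the corresponding permutation of the remaining blocks), and coincidence of canonical forms is understood up to such permutations. *)

theory Defs
  imports "HOL-Library.Multiset" "HOL-Combinatorics.Permutations" "HOL-Algebra.QuotRing" "HOL-Algebra.Ideal_Product"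
begin

section \<open>Prime radical, indecomposable rings, the \<open>(n,m)\<close>-condition\<close>

text \<open>
  The locale \<^locale>\<open>primeideal\<close> presupposes a commutative ring and is elementwise. For arbitrary
  rings, primeness is expressed by products of two-sided ideals.
\<close>

definition nc_prime_ideal :: "('a, 'b) ring_scheme \<Rightarrow> 'a set \<Rightarrow> bool" where
  "nc_prime_ideal R P \<longleftrightarrow>
     ideal P R \<and> P \<noteq> carrier R \<and>
     (\<forall>I J. ideal I R \<longrightarrow> ideal J R \<longrightarrow> ideal_prod R I J \<subseteq> P \<longrightarrow> I \<subseteq> P \<or> J \<subseteq> P)"

definition prime_radical :: "('a, 'b) ring_scheme \<Rightarrow> 'a set" where
  "prime_radical R = {x \<in> carrier R. \<forall>P. nc_prime_ideal R P \<longrightarrow> x \<in> P}"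

definition ring_center :: "('a, 'b) ring_scheme \<Rightarrow> 'a set" where
  "ring_center R = {c \<in> carrier R. \<forall>x \<in> carrier R. c \<otimes>\<^bsub>R\<^esub> x = x \<otimes>\<^bsub>R\<^esub> c}"

definition indecomposable_ring :: "('a, 'b) ring_scheme \<Rightarrow> bool" where
  "indecomposable_ring R \<longleftrightarrow> {e \<in> ring_center R. e \<otimes>\<^bsub>R\<^esub> e = e} = {\<zero>\<^bsub>R\<^esub>, \<one>\<^bsub>R\<^esub>}"

text \<open>
  Here and below, an \<open>n \<times> n\<close> matrix is a function on \<open>{1..n} \<times> {1..n}\<close>, extended by
  \<^const>\<open>undefined\<close>, so that equality of matrices is equality of entries.
\<close>

definition matrix_ring :: "nat \<Rightarrow> ('a, 'b) ring_scheme \<Rightarrow> (nat \<times> nat \<Rightarrow> 'a) ring" where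
  "matrix_ring n R =
    \<lparr>carrier = {1..n} \<times> {1..n} \<rightarrow>\<^sub>E carrier R,
     mult = (\<lambda>A B. \<lambda>(i, j) \<in> {1..n} \<times> {1..n}. \<Oplus>\<^bsub>R\<^esub>k \<in> {1..n}. A (i, k) \<otimes>\<^bsub>R\<^esub> B (k, j)),
     one = (\<lambda>(i, j) \<in> {1..n} \<times> {1..n}. if i = j then \<one>\<^bsub>R\<^esub> else \<zero>\<^bsub>R\<^esub>),
     zero = (\<lambda>(i, j) \<in> {1..n} \<times> {1..n}. \<zero>\<^bsub>R\<^esub>),
     add = (\<lambda>A B. \<lambda>(i, j) \<in> {1..n} \<times> {1..n}. A (i, j) \<oplus>\<^bsub>R\<^esub> B (i, j))\<rparr>"

definition nm_condition :: "('a, 'b) ring_scheme \<Rightarrow> bool" where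
  "nm_condition R \<longleftrightarrow>
     (\<forall>n m. 0 < n \<longrightarrow> 0 < m \<longrightarrow> matrix_ring n R \<simeq> matrix_ring m R \<longrightarrow> n = m)"


section \<open>Formal matrix rings\<close>

definition multiplier_system ::
    "nat \<Rightarrow> ('a, 'b) ring_scheme \<Rightarrow> (nat \<Rightarrow> nat \<Rightarrow> nat \<Rightarrow> 'a) \<Rightarrow> bool" where
  "multiplier_system n R s \<longleftrightarrow>
     (\<forall>i\<in>{1..n}. \<forall>j\<in>{1..n}. \<forall>k\<in>{1..n}. s i j k \<in> ring_center R) \<and>
     (\<forall>i\<in>{1..n}. \<forall>k\<in>{1..n}. s i i k = \<one>\<^bsub>R\<^esub> \<and> s i k k = \<one>\<^bsub>R\<^esub>) \<and>
     (\<forall>i\<in>{1..n}. \<forall>j\<in>{1..n}. \<forall>k\<in>{1..n}. \<forall>l\<in>{1..n}.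
        s i j k \<otimes>\<^bsub>R\<^esub> s i k l = s i j l \<otimes>\<^bsub>R\<^esub> s j k l)"

definition formal_matrix_ring ::
    "nat \<Rightarrow> ('a, 'b) ring_scheme \<Rightarrow> (nat \<Rightarrow> nat \<Rightarrow> nat \<Rightarrow> 'a) \<Rightarrow> (nat \<times> nat \<Rightarrow> 'a) ring" where
  "formal_matrix_ring n R s =
    \<lparr>carrier = {1..n} \<times> {1..n} \<rightarrow>\<^sub>E carrier R,
     mult = (\<lambda>A B. \<lambda>(i, j) \<in> {1..n} \<times> {1..n}.
               \<Oplus>\<^bsub>R\<^esub>k \<in> {1..n}. s i k j \<otimes>\<^bsub>R\<^esub> A (i, k) \<otimes>\<^bsub>R\<^esub> B (k, j)),
     one = (\<lambda>(i, j) \<in> {1..n} \<times> {1..n}. if i = j then \<one>\<^bsub>R\<^esub> else \<zero>\<^bsub>R\<^esub>),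
     zero = (\<lambda>(i, j) \<in> {1..n} \<times> {1..n}. \<zero>\<^bsub>R\<^esub>),
     add = (\<lambda>A B. \<lambda>(i, j) \<in> {1..n} \<times> {1..n}. A (i, j) \<oplus>\<^bsub>R\<^esub> B (i, j))\<rparr>"

definition multipliers_01 ::
    "nat \<Rightarrow> ('a, 'b) ring_scheme \<Rightarrow> (nat \<Rightarrow> nat \<Rightarrow> nat \<Rightarrow> 'a) \<Rightarrow> bool" where
  "multipliers_01 n R s \<longleftrightarrow>
     multiplier_system n R s \<and>
     (\<forall>i\<in>{1..n}. \<forall>j\<in>{1..n}. \<forall>k\<in>{1..n}. s i j k \<in> {\<zero>\<^bsub>R\<^esub>, \<one>\<^bsub>R\<^esub>})"

definition form_K0 ::
    "nat \<Rightarrow> ('a, 'b) ring_scheme \<Rightarrow> (nat \<Rightarrow> nat \<Rightarrow> nat \<Rightarrow> 'a) \<Rightarrow> bool" where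
  "form_K0 n R s \<longleftrightarrow>
     (\<forall>i\<in>{1..n}. \<forall>j\<in>{1..n}. \<forall>k\<in>{1..n}.
        i \<noteq> j \<longrightarrow> j \<noteq> k \<longrightarrow> i \<noteq> k \<longrightarrow> s i j i = \<zero>\<^bsub>R\<^esub> \<longrightarrow> s j k j = \<zero>\<^bsub>R\<^esub> \<longrightarrow> s i j k = \<zero>\<^bsub>R\<^esub>)"

definition principal_multiplier_matrix ::
    "nat \<Rightarrow> (nat \<Rightarrow> nat \<Rightarrow> nat \<Rightarrow> 'a) \<Rightarrow> nat \<times> nat \<Rightarrow> 'a" where
  "principal_multiplier_matrix n s = (\<lambda>(i, j) \<in> {1..n} \<times> {1..n}. s i j i)"


section \<open>Canonical form\<close>

definition permute_matrix ::
    "nat \<Rightarrow> (nat \<Rightarrow> nat) \<Rightarrow> (nat \<times> nat \<Rightarrow> 'a) \<Rightarrow> nat \<times> nat \<Rightarrow> 'a" where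
  "permute_matrix n \<sigma> A = (\<lambda>(i, j) \<in> {1..n} \<times> {1..n}. A (\<sigma> i, \<sigma> j))"

text \<open>
  The block diagonal matrix of order \<^term>\<open>sum_list ns\<close> whose successive diagonal blocks are
  all-ones matrices of orders \<open>ns ! 0, ns ! 1, \<dots>\<close>; the \<open>t\<close>-th block occupies the
  index set \<^term>\<open>block_indices ns t\<close>.
\<close>

definition block_indices :: "nat list \<Rightarrow> nat \<Rightarrow> nat set" where
  "block_indices ns t = {sum_list (take t ns) <.. sum_list (take (Suc t) ns)}"

definition block_ones_matrix :: "('a, 'b) ring_scheme \<Rightarrow> nat list \<Rightarrow> nat \<times> nat \<Rightarrow> 'a" where
  "block_ones_matrix R ns =
     (\<lambda>(i, j) \<in> {1..sum_list ns} \<times> {1..sum_list ns}.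
        if \<exists>t < length ns. i \<in> block_indices ns t \<and> j \<in> block_indices ns t
        then \<one>\<^bsub>R\<^esub> else \<zero>\<^bsub>R\<^esub>)"

definition canonical_form_of ::
    "nat \<Rightarrow> ('a, 'b) ring_scheme \<Rightarrow> (nat \<times> nat \<Rightarrow> 'a) \<Rightarrow> nat list \<Rightarrow> bool" where
  "canonical_form_of n R A ns \<longleftrightarrow>
     sum_list ns = n \<and> 0 \<notin> set ns \<and>
     (\<exists>\<sigma>. \<sigma> permutes {1..n} \<and> permute_matrix n \<sigma> A = block_ones_matrix R ns)"

text \<open>
  Canonical forms are compared up to a permutation of the diagonal blocks, that is, up to the
  order of the entries of the list of block sizes.
\<close>

definition same_canonical_forms ::
    "nat \<Rightarrow> ('a, 'b) ring_scheme \<Rightarrow> (nat \<times> nat \<Rightarrow> 'a) \<Rightarrow> (nat \<times> nat \<Rightarrow> 'a) \<Rightarrow> bool" where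
  "same_canonical_forms n R A B \<longleftrightarrow>
     (\<exists>ns ms. canonical_form_of n R A ns \<and> canonical_form_of n R B ms \<and> mset ns = mset ms)"

end

theory Submission
  imports Defs
begin

text \<open>
  Call indices \<open>i\<close> and \<open>j\<close> similar if \<open>s i j i = \<one>\<close>. The multiplier identities make this an
  equivalence relation, and the canonical form of the principal multiplier matrix records
  the multiset of the sizes of its classes.

  For the second assertion: in the form \<open>K\<^sub>0\<close> a multiplier \<open>s i j k\<close> is one exactly when \<open>i\<close> is
  similar to \<open>j\<close> or \<open>j\<close> is similar to \<open>k\<close> (\<open>K0_multiplier\<close>). So similarity determines the ring, and
  a bijection of the indices that carries one similarity relation to the other induces an
  isomorphism (\<open>ring_iso_reindex\<close>).

  For the first assertion the classes have to be recovered from the ring \<open>K\<close>. A product that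
  leaves a class and returns to it has multiplier zero, so the diagonal block on a class \<open>C\<close>
  defines a ring homomorphism from \<open>K\<close> onto the ordinary matrices of order \<open>card C\<close> over
  \<open>R/P(R)\<close>. The prime radical of \<open>K\<close> is the common kernel of these homomorphisms
  (\<open>prime_radical_K\<close>): a prime ideal of \<open>R\<close> gives a prime ideal of \<open>K\<close> for each class; conversely
  a prime ideal of \<open>K\<close> contains all entries outside the diagonal blocks, because a matrix with one
  such entry annihilates itself when sandwiched around any matrix, and it contains \<open>P(R)\<close> inside
  the blocks. Hence \<open>K/P(K)\<close> is the product of the matrix rings of orders \<open>card C\<close> over \<open>R/P(R)\<close>
  (\<open>splitting\<close>), and these factors are indecomposable since the centre of a matrix ring consists of
  scalar matrices (\<open>indecomposable_K\<close>).

  An isomorphism of formal matrix rings preserves the prime radical, so it yields two such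
  decompositions of one ring. Decompositions into indecomposable factors are unique
  (\<open>components_match\<close>): the central idempotents of one decomposition become \<open>\<zero>\<close> or \<open>\<one>\<close> in each
  factor of the other. This matches the classes in such a way that matched classes have
  isomorphic matrix rings over \<open>R/P(R)\<close>, and the \<open>(n,m)\<close>-condition shows that matched classes have
  equal size.
\<close>

section \<open>Canonical forms and colourings\<close>

text \<open>
  A colouring of a finite set is determined, up to relabelling the points, by the sizes of its
  fibres: bijections between corresponding fibres glue together.
\<close>

lemma bij_matching_fibres:
  assumes "finite A" "finite B" and g: "bij_betw g (c ` A) (d ` B)"
    and card: "\<And>i. i \<in> c ` A \<Longrightarrow> card {x \<in> A. c x = i} = card {y \<in> B. d y = g i}"
  obtains f where "bij_betw f A B" "\<And>x. x \<in> A \<Longrightarrow> d (f x) = g (c x)"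
proof -
  have "\<exists>h. bij_betw h {x \<in> A. c x = i} {y \<in> B. d y = g i}" if "i \<in> c ` A" for i
    by (rule finite_same_card_bij[OF _ _ card[OF that]]) (use assms(1,2) in simp_all)
  then have "\<exists>h. \<forall>i\<in>c ` A. bij_betw (h i) {x \<in> A. c x = i} {y \<in> B. d y = g i}"
    by (intro bchoice ballI)
  then obtain h where h: "\<And>i. i \<in> c ` A \<Longrightarrow> bij_betw (h i) {x \<in> A. c x = i} {y \<in> B. d y = g i}"
    by blast
  define f where "f = (\<lambda>x. h (c x) x)"
  have fB: "f x \<in> B \<and> d (f x) = g (c x)" if "x \<in> A" for x
    using bij_betwE[OF h[OF imageI[OF that]]] that unfolding f_def by blast
  have "inj_on f A"
  proof (rule inj_onI)
    fix x y assume xy: "x \<in> A" "y \<in> A" "f x = f y"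
    then have "g (c x) = g (c y)" using fB by metis
    then have "c x = c y"
      by (rule inj_onD[OF bij_betw_imp_inj_on[OF g]]) (use xy in simp_all)
    then show "x = y"
      by (intro inj_onD[OF bij_betw_imp_inj_on[OF h[OF imageI[OF xy(1)]]]])
        (use xy in \<open>simp_all add: f_def\<close>)
  qed
  moreover have "f ` A = B"
  proof
    show "B \<subseteq> f ` A"
    proof
      fix y assume y: "y \<in> B"
      then obtain x where x: "x \<in> A" "d y = g (c x)"
        using bij_betw_imp_surj_on[OF g, THEN equalityD2] by blast
      have "h (c x) ` {z \<in> A. c z = c x} = {y \<in> B. d y = g (c x)}"
        by (rule bij_betw_imp_surj_on[OF h]) (use x(1) in simp)
      then have "y \<in> h (c x) ` {z \<in> A. c z = c x}" using x y by simp
      then obtain z where "z \<in> A" "y = f z" by (auto simp: f_def)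
      then show "y \<in> f ` A" by blast
    qed
  qed (use fB in auto)
  ultimately show thesis using that fB by (auto simp: bij_betw_def)
qed

text \<open>
  Reading the block of an index as its colour makes block diagonal matrices of ones instances of
  matrices that record when two indices have equal colour.
\<close>

definition block_of :: "nat list \<Rightarrow> nat \<Rightarrow> nat" where
  "block_of ns i = (THE t. t < length ns \<and> i \<in> block_indices ns t)"

lemma sum_list_take_mono: "t \<le> u \<Longrightarrow> sum_list (take t ns) \<le> sum_list (take u ns)" for ns :: "nat list"
  by (metis le_add1 le_Suc_ex sum_list_append take_add)

lemma block_indices_unique:
  assumes "i \<in> block_indices ns t" "i \<in> block_indices ns u"
  shows "t = u"
proof -
  have "\<not> t < u" if "i \<in> block_indices ns t" "i \<in> block_indices ns u" for t u
    using that sum_list_take_mono[of "Suc t" u ns] by (auto simp: block_indices_def)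
  then show ?thesis using assms by (metis linorder_neqE_nat)
qed

lemma block_indices_cover:
  assumes "i \<in> {1..sum_list ns}"
  obtains t where "t < length ns" "i \<in> block_indices ns t"
proof -
  \<comment> \<open>The block of \<open>i\<close> is the last one before the partial sums reach \<open>i\<close>.\<close>
  define u where "u = (LEAST u. i \<le> sum_list (take u ns))"
  have le: "i \<le> sum_list (take u ns)"
    unfolding u_def by (rule LeastI[of _ "length ns"]) (use assms in simp)
  have u0: "u \<noteq> 0" using le assms by (auto intro: ccontr)
  then obtain t where t: "u = Suc t" by (cases u) auto
  have gt: "sum_list (take t ns) < i"
    using not_less_Least[of t "\<lambda>u. i \<le> sum_list (take u ns)"] t unfolding u_def by auto
  have "t < length ns"
    using gt assms by (cases "t < length ns") auto
  then show thesis using that gt le t by (auto simp: block_indices_def)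
qed

lemma block_of_eqI: "t < length ns \<Longrightarrow> i \<in> block_indices ns t \<Longrightarrow> block_of ns i = t"
  unfolding block_of_def using block_indices_unique by blast

lemma block_of:
  assumes "i \<in> {1..sum_list ns}"
  shows "block_of ns i < length ns" "i \<in> block_indices ns (block_of ns i)"
  using block_indices_cover[OF assms] block_of_eqI by metis+

lemma block_of_fibre:
  assumes "t < length ns"
  shows "{i \<in> {1..sum_list ns}. block_of ns i = t} = block_indices ns t"
proof -
  have "block_indices ns t \<subseteq> {1..sum_list ns}"
    using sum_list_take_mono[of "Suc t" "length ns" ns] assms by (auto simp: block_indices_def)
  then show ?thesis using block_of(2) block_of_eqI[OF assms] by blast
qed

lemma card_block_indices: "t < length ns \<Longrightarrow> card (block_indices ns t) = ns ! t"
  by (simp add: block_indices_def take_Suc_conv_app_nth)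

lemma block_of_image:
  assumes "0 \<notin> set ns"
  shows "block_of ns ` {1..sum_list ns} = {..<length ns}"
proof
  show "{..<length ns} \<subseteq> block_of ns ` {1..sum_list ns}"
  proof
    fix t assume t: "t \<in> {..<length ns}"
    then have "card (block_indices ns t) \<noteq> 0"
      using assms by (metis card_block_indices lessThan_iff nth_mem)
    then have "block_indices ns t \<noteq> {}" by auto
    then obtain i where "i \<in> block_indices ns t" by blast
    then have "i \<in> {i \<in> {1..sum_list ns}. block_of ns i = t}"
      using block_of_fibre[of t ns] t by simp
    then show "t \<in> block_of ns ` {1..sum_list ns}" by auto
  qed
qed (use block_of in auto)

lemma block_ones_matrix_entry:
  assumes "i \<in> {1..sum_list ns}" "j \<in> {1..sum_list ns}"
  shows "block_ones_matrix R ns (i, j) =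
    (if block_of ns i = block_of ns j then \<one>\<^bsub>R\<^esub> else \<zero>\<^bsub>R\<^esub>)"
proof -
  have "(\<exists>t < length ns. i \<in> block_indices ns t \<and> j \<in> block_indices ns t)
      \<longleftrightarrow> block_of ns i = block_of ns j"
  proof
    assume "\<exists>t < length ns. i \<in> block_indices ns t \<and> j \<in> block_indices ns t"
    then show "block_of ns i = block_of ns j" by (auto simp: block_of_eqI)
  next
    assume "block_of ns i = block_of ns j"
    then show "\<exists>t < length ns. i \<in> block_indices ns t \<and> j \<in> block_indices ns t"
      using block_of[OF assms(1)] block_of(2)[OF assms(2)] by auto
  qed
  then show ?thesis using assms unfolding block_ones_matrix_def by simp
qed

lemma permutes_of_bij:
  assumes "bij_betw f S S"
  obtains \<sigma> where "\<sigma> permutes S" "\<And>x. x \<in> S \<Longrightarrow> \<sigma> x = f x"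
proof
  show "(\<lambda>x. if x \<in> S then f x else x) permutes S"
    by (rule bij_imp_permutes) (use assms in \<open>auto cong: bij_betw_cong\<close>)
qed simp

text \<open>
  The blocks of the canonical form are the colour classes, and the colours may be listed in any
  order. This freedom makes it possible to give two matrices the same list of block sizes instead
  of two lists that are permutations of each other.
\<close>

lemma canonical_form_of_colouring:
  assumes A: "\<And>i j. \<lbrakk>i \<in> {1..n}; j \<in> {1..n}\<rbrakk> \<Longrightarrow>
      A (i, j) = (if c i = c j then \<one>\<^bsub>R\<^esub> else \<zero>\<^bsub>R\<^esub>)"
    and xs: "distinct xs" "set xs = c ` {1..n}"
  shows "canonical_form_of n R A (map (\<lambda>x. card {i \<in> {1..n}. c i = x}) xs)"
proof -
  define ns where "ns = map (\<lambda>x. card {i \<in> {1..n}. c i = x}) xs"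
  have "sum_list ns = (\<Sum>x\<in>c ` {1..n}. card {i \<in> {1..n}. c i = x})"
    unfolding ns_def xs(2)[symmetric] by (rule sum_list_distinct_conv_sum_set[OF xs(1)])
  also have "\<dots> = n"
    using sum_card_image sum.image_gen[of "{1..n}" "\<lambda>_. 1::nat" c] by simp
  finally have sum: "sum_list ns = n" .
  have pos: "0 \<notin> set ns" unfolding ns_def using xs by auto
  have "bij_betw (\<lambda>t. xs ! t) (block_of ns ` {1..n}) (c ` {1..n})"
    using bij_betw_nth[OF xs(1) _ xs(2)[symmetric]] block_of_image[OF pos] sum
    by (simp add: ns_def)
  moreover have "card {i \<in> {1..n}. block_of ns i = t} = card {i \<in> {1..n}. c i = xs ! t}"
    if "t \<in> block_of ns ` {1..n}" for t
  proof -
    have t: "t < length ns" using that block_of(1) sum by auto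
    then show ?thesis
      using block_of_fibre[OF t] card_block_indices[OF t] sum by (simp add: ns_def)
  qed
  ultimately obtain f where f: "bij_betw f {1..n} {1..n}"
      "\<And>i. i \<in> {1..n} \<Longrightarrow> c (f i) = xs ! block_of ns i"
    using bij_matching_fibres[of "{1..n}" "{1..n}" "\<lambda>t. xs ! t" "block_of ns" c] by auto
  obtain \<sigma> where \<sigma>: "\<sigma> permutes {1..n}" "\<And>x. x \<in> {1..n} \<Longrightarrow> \<sigma> x = f x"
    using permutes_of_bij[OF f(1)] by blast
  have "permute_matrix n \<sigma> A (i, j) = block_ones_matrix R ns (i, j)" for i j
  proof (cases "i \<in> {1..n} \<and> j \<in> {1..n}")
    case True
    then have "f i \<in> {1..n}" "f j \<in> {1..n}" using f(1) by (auto dest: bij_betwE)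
    moreover have "xs ! block_of ns i = xs ! block_of ns j \<longleftrightarrow> block_of ns i = block_of ns j"
      using True block_of(1)[of _ ns] sum xs(1) by (auto simp: ns_def nth_eq_iff_index_eq)
    ultimately show ?thesis
      using True A f(2) block_ones_matrix_entry[of i ns j R] sum \<sigma>(2)
      by (simp add: permute_matrix_def)
  next
    case False
    then show ?thesis using sum by (auto simp: permute_matrix_def block_ones_matrix_def)
  qed
  then show ?thesis
    using \<sigma>(1) sum pos unfolding canonical_form_of_def ns_def[symmetric] by (auto simp: fun_eq_iff)
qed

text \<open>
  The permutations that bring both matrices into canonical form, together with a bijection that
  matches blocks of equal size, compose to a single relabelling of the indices.
\<close>

lemma same_canonical_formsE:
  assumes same_forms: "same_canonical_forms n R A B"
  obtains f where "bij_betw f {1..n} {1..n}"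
    "\<And>i j. \<lbrakk>i \<in> {1..n}; j \<in> {1..n}\<rbrakk> \<Longrightarrow> A (f i, f j) = B (i, j)"
proof -
  obtain ns ms \<sigma> \<tau> where
    ns: "sum_list ns = n" "0 \<notin> set ns" and ms: "sum_list ms = n" "0 \<notin> set ms"
    and \<sigma>: "\<sigma> permutes {1..n}" "permute_matrix n \<sigma> A = block_ones_matrix R ns"
    and \<tau>: "\<tau> permutes {1..n}" "permute_matrix n \<tau> B = block_ones_matrix R ms"
    and mset: "mset ns = mset ms"
    using same_forms unfolding same_canonical_forms_def canonical_form_of_def by auto
  obtain p where p: "p permutes {..<length ns}" "permute_list p ns = ms"
    using mset_eq_permutation[OF mset[symmetric]] .
  have len: "length ns = length ms" using mset by (metis size_mset)
  have nth: "ms ! t = ns ! p t" if "t < length ms" for t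
    using p that len permute_list_nth[OF p(1)] by auto
  have pl: "p t < length ns" if "t < length ms" for t
    using permutes_in_image[OF p(1), of t] that len by simp
  have "bij_betw p (block_of ms ` {1..n}) (block_of ns ` {1..n})"
    using permutes_imp_bij[OF p(1)] block_of_image[OF ns(2)] block_of_image[OF ms(2)] ns ms len by simp
  moreover have "card {i \<in> {1..n}. block_of ms i = t} = card {i \<in> {1..n}. block_of ns i = p t}"
    if "t \<in> block_of ms ` {1..n}" for t
  proof -
    have t: "t < length ms" using that block_of(1) ms by auto
    show ?thesis
      using block_of_fibre[OF t] card_block_indices[OF t] block_of_fibre[OF pl[OF t]]
        card_block_indices[OF pl[OF t]] ns ms nth[OF t] by simp
  qed
  ultimately obtain f where f: "bij_betw f {1..n} {1..n}"
      "\<And>i. i \<in> {1..n} \<Longrightarrow> block_of ns (f i) = p (block_of ms i)"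
    using bij_matching_fibres[of "{1..n}" "{1..n}" p "block_of ms" "block_of ns"] by auto
  have fin: "f i \<in> {1..n}" if "i \<in> {1..n}" for i using f(1) that by (auto dest: bij_betwE)
  \<comment> \<open>The map \<open>f\<close> relabels the blocks of one canonical form as those of the other.\<close>
  have eq: "A (\<sigma> (f i), \<sigma> (f j)) = B (\<tau> i, \<tau> j)" if ij: "i \<in> {1..n}" "j \<in> {1..n}" for i j
  proof -
    have "A (\<sigma> (f i), \<sigma> (f j)) = block_ones_matrix R ns (f i, f j)"
      using \<sigma>(2)[symmetric] fin ij by (simp add: permute_matrix_def)
    also have "\<dots> = block_ones_matrix R ms (i, j)"
      using block_ones_matrix_entry[of "f i" ns "f j" R] block_ones_matrix_entry[of i ms j R]
        fin ij f(2) ns(1) ms(1) permutes_inj[OF p(1)] by (simp add: inj_eq)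
    also have "\<dots> = B (\<tau> i, \<tau> j)"
      using \<tau>(2)[symmetric] ij by (simp add: permute_matrix_def)
    finally show ?thesis .
  qed
  show thesis
  proof
    show "bij_betw (\<sigma> \<circ> (f \<circ> inv_into UNIV \<tau>)) {1..n} {1..n}"
      using bij_betw_trans[OF bij_betw_trans[OF permutes_imp_bij[OF permutes_inv[OF \<tau>(1)]] f(1)]
          permutes_imp_bij[OF \<sigma>(1)]] .
    fix i j assume ij: "i \<in> {1..n}" "j \<in> {1..n}"
    have "inv_into UNIV \<tau> i \<in> {1..n}" "inv_into UNIV \<tau> j \<in> {1..n}"
      using permutes_in_image[OF permutes_inv[OF \<tau>(1)]] ij by blast+
    from eq[OF this] show "A ((\<sigma> \<circ> (f \<circ> inv_into UNIV \<tau>)) i, (\<sigma> \<circ> (f \<circ> inv_into UNIV \<tau>)) j) = B (i, j)"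
      using permutes_inverses(1)[OF \<tau>(1)] by simp
  qed
qed

section \<open>Formal matrix rings are rings\<close>

lemma (in abelian_monoid) finsum_swap:
  assumes "finite B" and f: "\<And>i j. i \<in> A \<Longrightarrow> j \<in> B \<Longrightarrow> f i j \<in> carrier G"
  shows "(\<Oplus>i\<in>A. \<Oplus>j\<in>B. f i j) = (\<Oplus>j\<in>B. \<Oplus>i\<in>A. f i j)"
  using assms
proof (induction B rule: finite_induct)
  case empty
  then show ?case by (simp add: finsum_zero)
next
  case (insert b B)
  have "(\<Oplus>i\<in>A. \<Oplus>j\<in>insert b B. f i j) = (\<Oplus>i\<in>A. f i b \<oplus> (\<Oplus>j\<in>B. f i j))"
    using insert by (intro finsum_cong') (auto intro!: finsum_closed finsum_insert)
  also have "\<dots> = (\<Oplus>i\<in>A. f i b) \<oplus> (\<Oplus>i\<in>A. \<Oplus>j\<in>B. f i j)"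
    using insert by (intro finsum_addf) (auto intro!: finsum_closed)
  also have "\<dots> = (\<Oplus>j\<in>insert b B. \<Oplus>i\<in>A. f i j)"
    using insert by (subst finsum_insert) (auto intro!: finsum_closed)
  finally show ?case .
qed

lemma (in abelian_monoid) finsum_eq_single:
  assumes "finite A" "i \<in> A" "f i \<in> carrier G"
    and "\<And>j. j \<in> A \<Longrightarrow> j \<noteq> i \<Longrightarrow> f j = \<zero>"
  shows "finsum G f A = f i"
proof -
  have "finsum G f A = (\<Oplus>j\<in>A. if i = j then f i else \<zero>)"
    using assms by (intro finsum_cong') auto
  also have "\<dots> = f i"
    by (rule finsum_singleton) (use assms in auto)
  finally show ?thesis .
qed

lemma (in ring_hom_ring) hom_finsum_carrier:
  assumes "\<And>i. i \<in> A \<Longrightarrow> f i \<in> carrier R"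
  shows "h (finsum R f A) = finsum S (\<lambda>i. h (f i)) A"
  using assms by (induction A rule: infinite_finite_induct) (auto simp: Pi_def)

locale formal_matrices = ring R for R (structure) +
  fixes n :: nat and s :: "nat \<Rightarrow> nat \<Rightarrow> nat \<Rightarrow> 'a"
  assumes multiplier_system: "multiplier_system n R s"
begin

text \<open>
  The default simplification of \<open>i \<in> {1..n}\<close> into two inequalities would keep the facts about
  indices from matching, so membership in the index set is treated as atomic.
\<close>

context
  notes [simp del] = atLeastAtMost_iff One_nat_def
begin

abbreviation K :: "(nat \<times> nat \<Rightarrow> 'a) ring" where
  "K \<equiv> formal_matrix_ring n R s"

lemma multiplier_closed:
  "\<lbrakk>i \<in> {1..n}; j \<in> {1..n}; k \<in> {1..n}\<rbrakk> \<Longrightarrow> s i j k \<in> carrier R"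
  using multiplier_system unfolding multiplier_system_def ring_center_def by blast

lemma multiplier_central:
  "\<lbrakk>i \<in> {1..n}; j \<in> {1..n}; k \<in> {1..n}; x \<in> carrier R\<rbrakk> \<Longrightarrow> s i j k \<otimes> x = x \<otimes> s i j k"
  using multiplier_system unfolding multiplier_system_def ring_center_def by blast

lemma multiplier_left: "\<lbrakk>i \<in> {1..n}; k \<in> {1..n}\<rbrakk> \<Longrightarrow> s i i k = \<one>"
  and multiplier_right: "\<lbrakk>i \<in> {1..n}; k \<in> {1..n}\<rbrakk> \<Longrightarrow> s i k k = \<one>"
  using multiplier_system unfolding multiplier_system_def by blast+

lemma multiplier_assoc:
  "\<lbrakk>i \<in> {1..n}; j \<in> {1..n}; k \<in> {1..n}; l \<in> {1..n}\<rbrakk> \<Longrightarrow>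
    s i j k \<otimes> s i k l = s i j l \<otimes> s j k l"
  using multiplier_system unfolding multiplier_system_def by blast

lemma carrier_K: "carrier K = {1..n} \<times> {1..n} \<rightarrow>\<^sub>E carrier R"
  by (simp add: formal_matrix_ring_def)

lemma entry_closed [simp]:
  "\<lbrakk>A \<in> carrier K; i \<in> {1..n}; j \<in> {1..n}\<rbrakk> \<Longrightarrow> A (i, j) \<in> carrier R"
  by (auto simp: carrier_K)

lemma matrix_eqI:
  assumes "A \<in> carrier K" "B \<in> carrier K"
    and "\<And>i j. \<lbrakk>i \<in> {1..n}; j \<in> {1..n}\<rbrakk> \<Longrightarrow> A (i, j) = B (i, j)"
  shows "A = B"
  using assms unfolding carrier_K by (intro PiE_ext[of A _ _ B]) auto

lemma mult_entry:
  "\<lbrakk>i \<in> {1..n}; j \<in> {1..n}\<rbrakk> \<Longrightarrow>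
    (A \<otimes>\<^bsub>K\<^esub> B) (i, j) = (\<Oplus>k\<in>{1..n}. s i k j \<otimes> A (i, k) \<otimes> B (k, j))"
  by (simp add: formal_matrix_ring_def)

lemma add_entry:
  "\<lbrakk>i \<in> {1..n}; j \<in> {1..n}\<rbrakk> \<Longrightarrow> (A \<oplus>\<^bsub>K\<^esub> B) (i, j) = A (i, j) \<oplus> B (i, j)"
  by (simp add: formal_matrix_ring_def)

lemma zero_entry: "\<lbrakk>i \<in> {1..n}; j \<in> {1..n}\<rbrakk> \<Longrightarrow> \<zero>\<^bsub>K\<^esub> (i, j) = \<zero>"
  by (simp add: formal_matrix_ring_def)

lemma one_entry:
  "\<lbrakk>i \<in> {1..n}; j \<in> {1..n}\<rbrakk> \<Longrightarrow> \<one>\<^bsub>K\<^esub> (i, j) = (if i = j then \<one> else \<zero>)"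
  by (simp add: formal_matrix_ring_def)

lemma mult_term_closed:
  "\<lbrakk>A \<in> carrier K; B \<in> carrier K; i \<in> {1..n}; j \<in> {1..n}; k \<in> {1..n}\<rbrakk> \<Longrightarrow>
    s i k j \<otimes> A (i, k) \<otimes> B (k, j) \<in> carrier R"
  by (intro m_closed multiplier_closed entry_closed)

lemma K_mult_closed: "\<lbrakk>A \<in> carrier K; B \<in> carrier K\<rbrakk> \<Longrightarrow> A \<otimes>\<^bsub>K\<^esub> B \<in> carrier K"
  by (auto simp: formal_matrix_ring_def intro!: finsum_closed m_closed multiplier_closed)

lemma K_add_closed: "\<lbrakk>A \<in> carrier K; B \<in> carrier K\<rbrakk> \<Longrightarrow> A \<oplus>\<^bsub>K\<^esub> B \<in> carrier K"
  by (auto simp: formal_matrix_ring_def)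

lemma K_zero_closed: "\<zero>\<^bsub>K\<^esub> \<in> carrier K"
  and K_one_closed: "\<one>\<^bsub>K\<^esub> \<in> carrier K"
  by (auto simp: formal_matrix_ring_def)

text \<open>
  In both bracketings the summand \<open>A (i, k) \<otimes> B (k, l) \<otimes> C (l, j)\<close> carries two multipliers, and the
  defining identity of a multiplier system says that the two products of multipliers agree.
\<close>

lemma K_mult_assoc:
  assumes A: "A \<in> carrier K" and B: "B \<in> carrier K" and C: "C \<in> carrier K"
  shows "A \<otimes>\<^bsub>K\<^esub> B \<otimes>\<^bsub>K\<^esub> C = A \<otimes>\<^bsub>K\<^esub> (B \<otimes>\<^bsub>K\<^esub> C)"
proof (rule matrix_eqI)
  fix i j assume ij: "i \<in> {1..n}" "j \<in> {1..n}"
  let ?N = "{1..n}"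
  have term_eq: "s i l j \<otimes> (s i k l \<otimes> A (i, k) \<otimes> B (k, l)) \<otimes> C (l, j)
      = s i k j \<otimes> A (i, k) \<otimes> (s k l j \<otimes> B (k, l) \<otimes> C (l, j))"
    if kl: "k \<in> ?N" "l \<in> ?N" for k l
  proof -
    note cl = entry_closed[OF A ij(1) kl(1)] entry_closed[OF B kl] entry_closed[OF C kl(2) ij(2)]
      multiplier_closed[OF ij(1) kl(2) ij(2)] multiplier_closed[OF ij(1) kl]
      multiplier_closed[OF ij(1) kl(1) ij(2)] multiplier_closed[OF kl ij(2)]
    have "s i l j \<otimes> (s i k l \<otimes> A (i, k) \<otimes> B (k, l)) \<otimes> C (l, j)
        = (s i l j \<otimes> s i k l) \<otimes> (A (i, k) \<otimes> B (k, l) \<otimes> C (l, j))"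
      using cl by (simp add: m_assoc)
    also have "s i l j \<otimes> s i k l = s i k j \<otimes> s k l j"
      unfolding multiplier_central[OF ij(1) kl(2) ij(2) cl(5)]
      by (rule multiplier_assoc[OF ij(1) kl ij(2)])
    also have "\<dots> \<otimes> (A (i, k) \<otimes> B (k, l) \<otimes> C (l, j))
        = s i k j \<otimes> ((s k l j \<otimes> A (i, k)) \<otimes> (B (k, l) \<otimes> C (l, j)))"
      using cl by (simp add: m_assoc)
    also have "s k l j \<otimes> A (i, k) = A (i, k) \<otimes> s k l j"
      by (rule multiplier_central[OF kl ij(2) cl(1)])
    also have "s i k j \<otimes> (A (i, k) \<otimes> s k l j \<otimes> (B (k, l) \<otimes> C (l, j)))
        = s i k j \<otimes> A (i, k) \<otimes> (s k l j \<otimes> B (k, l) \<otimes> C (l, j))"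
      using cl by (simp add: m_assoc)
    finally show ?thesis .
  qed
  have "(A \<otimes>\<^bsub>K\<^esub> B \<otimes>\<^bsub>K\<^esub> C) (i, j)
      = (\<Oplus>l\<in>?N. s i l j \<otimes> (\<Oplus>k\<in>?N. s i k l \<otimes> A (i, k) \<otimes> B (k, l)) \<otimes> C (l, j))"
    unfolding mult_entry[OF ij]
    by (intro finsum_cong') (auto simp: mult_entry ij A B C intro!: m_closed multiplier_closed finsum_closed mult_term_closed)
  also have "\<dots> = (\<Oplus>l\<in>?N. \<Oplus>k\<in>?N. s i l j \<otimes> (s i k l \<otimes> A (i, k) \<otimes> B (k, l)) \<otimes> C (l, j))"
  proof (rule finsum_cong')
    fix l assume l: "l \<in> ?N"
    show "s i l j \<otimes> (\<Oplus>k\<in>?N. s i k l \<otimes> A (i, k) \<otimes> B (k, l)) \<otimes> C (l, j)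
        = (\<Oplus>k\<in>?N. s i l j \<otimes> (s i k l \<otimes> A (i, k) \<otimes> B (k, l)) \<otimes> C (l, j))"
      using l ij A B C
      by (subst finsum_rdistr finsum_ldistr;
          auto simp: Pi_def intro!: m_closed multiplier_closed finsum_closed mult_term_closed)+
  qed (auto simp: ij A B C intro!: m_closed multiplier_closed finsum_closed mult_term_closed)
  also have "\<dots> = (\<Oplus>l\<in>?N. \<Oplus>k\<in>?N. s i k j \<otimes> A (i, k) \<otimes> (s k l j \<otimes> B (k, l) \<otimes> C (l, j)))"
    by (intro finsum_cong' finsum_closed)
      (auto simp: term_eq ij A B C intro!: m_closed multiplier_closed finsum_closed)
  also have "\<dots> = (\<Oplus>k\<in>?N. \<Oplus>l\<in>?N. s i k j \<otimes> A (i, k) \<otimes> (s k l j \<otimes> B (k, l) \<otimes> C (l, j)))"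
    by (rule finsum_swap)
      (auto simp: ij A B C intro!: m_closed multiplier_closed)
  also have "\<dots> = (\<Oplus>k\<in>?N. s i k j \<otimes> A (i, k) \<otimes> (\<Oplus>l\<in>?N. s k l j \<otimes> B (k, l) \<otimes> C (l, j)))"
  proof (rule finsum_cong')
    fix k assume k: "k \<in> ?N"
    show "(\<Oplus>l\<in>?N. s i k j \<otimes> A (i, k) \<otimes> (s k l j \<otimes> B (k, l) \<otimes> C (l, j)))
        = s i k j \<otimes> A (i, k) \<otimes> (\<Oplus>l\<in>?N. s k l j \<otimes> B (k, l) \<otimes> C (l, j))"
      using k ij A B C
      by (subst finsum_rdistr;
          auto simp: Pi_def intro!: m_closed multiplier_closed mult_term_closed)
  qed (auto simp: ij A B C intro!: m_closed multiplier_closed finsum_closed mult_term_closed)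
  also have "\<dots> = (A \<otimes>\<^bsub>K\<^esub> (B \<otimes>\<^bsub>K\<^esub> C)) (i, j)"
    unfolding mult_entry[OF ij]
    by (intro finsum_cong') (auto simp: mult_entry ij A B C intro!: m_closed multiplier_closed finsum_closed mult_term_closed)
  finally show "(A \<otimes>\<^bsub>K\<^esub> B \<otimes>\<^bsub>K\<^esub> C) (i, j) = (A \<otimes>\<^bsub>K\<^esub> (B \<otimes>\<^bsub>K\<^esub> C)) (i, j)" .
qed (auto intro!: K_mult_closed A B C)

lemma K_abelian_group: "abelian_group K"
proof (rule abelian_groupI)
  fix A assume A: "A \<in> carrier K"
  let ?A' = "\<lambda>(i, j)\<in>{1..n} \<times> {1..n}. \<ominus> A (i, j)"
  have "?A' \<in> carrier K" using A by (auto simp: carrier_K)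
  moreover have "?A' \<oplus>\<^bsub>K\<^esub> A = \<zero>\<^bsub>K\<^esub>"
    using A calculation
    by (intro matrix_eqI K_add_closed K_zero_closed) (auto simp: add_entry zero_entry l_neg)
  ultimately show "\<exists>B\<in>carrier K. B \<oplus>\<^bsub>K\<^esub> A = \<zero>\<^bsub>K\<^esub>" by blast
next
  fix A B C assume A: "A \<in> carrier K" and B: "B \<in> carrier K" and C: "C \<in> carrier K"
  show "A \<oplus>\<^bsub>K\<^esub> B \<oplus>\<^bsub>K\<^esub> C = A \<oplus>\<^bsub>K\<^esub> (B \<oplus>\<^bsub>K\<^esub> C)"
    using A B C by (intro matrix_eqI K_add_closed) (auto simp: add_entry a_assoc)
  show "A \<oplus>\<^bsub>K\<^esub> B = B \<oplus>\<^bsub>K\<^esub> A"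
    using A B by (intro matrix_eqI K_add_closed) (auto simp: add_entry a_comm)
next
  fix A assume A: "A \<in> carrier K"
  show "\<zero>\<^bsub>K\<^esub> \<oplus>\<^bsub>K\<^esub> A = A"
    using A by (intro matrix_eqI K_add_closed K_zero_closed) (auto simp: add_entry zero_entry)
qed (auto intro: K_add_closed K_zero_closed)

lemma K_monoid: "Group.monoid K"
proof (rule monoidI)
  fix A assume A: "A \<in> carrier K"
  show "\<one>\<^bsub>K\<^esub> \<otimes>\<^bsub>K\<^esub> A = A"
  proof (rule matrix_eqI)
    fix i j assume ij: "i \<in> {1..n}" "j \<in> {1..n}"
    then show "(\<one>\<^bsub>K\<^esub> \<otimes>\<^bsub>K\<^esub> A) (i, j) = A (i, j)"
      unfolding mult_entry[OF ij]
      by (subst finsum_eq_single[of _ i])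
        (auto simp: one_entry multiplier_left A multiplier_closed)
  qed (auto intro!: K_mult_closed K_one_closed A)
  show "A \<otimes>\<^bsub>K\<^esub> \<one>\<^bsub>K\<^esub> = A"
  proof (rule matrix_eqI)
    fix i j assume ij: "i \<in> {1..n}" "j \<in> {1..n}"
    then show "(A \<otimes>\<^bsub>K\<^esub> \<one>\<^bsub>K\<^esub>) (i, j) = A (i, j)"
      unfolding mult_entry[OF ij]
      by (subst finsum_eq_single[of _ j])
        (auto simp: one_entry multiplier_right A multiplier_closed)
  qed (auto intro!: K_mult_closed K_one_closed A)
qed (auto intro: K_mult_closed K_one_closed K_mult_assoc)

lemma ring_K: "ring K"
proof (rule ringI[OF K_abelian_group K_monoid])
  fix A B C assume A: "A \<in> carrier K" and B: "B \<in> carrier K" and C: "C \<in> carrier K"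
  show "(A \<oplus>\<^bsub>K\<^esub> B) \<otimes>\<^bsub>K\<^esub> C = A \<otimes>\<^bsub>K\<^esub> C \<oplus>\<^bsub>K\<^esub> B \<otimes>\<^bsub>K\<^esub> C"
  proof (rule matrix_eqI)
    fix i j assume ij: "i \<in> {1..n}" "j \<in> {1..n}"
    have "((A \<oplus>\<^bsub>K\<^esub> B) \<otimes>\<^bsub>K\<^esub> C) (i, j) =
        (\<Oplus>k\<in>{1..n}. s i k j \<otimes> A (i, k) \<otimes> C (k, j) \<oplus> s i k j \<otimes> B (i, k) \<otimes> C (k, j))"
      unfolding mult_entry[OF ij] using A B C ij
      by (intro finsum_cong') (auto simp: add_entry r_distr l_distr multiplier_closed)
    also have "\<dots> = (\<Oplus>k\<in>{1..n}. s i k j \<otimes> A (i, k) \<otimes> C (k, j))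
        \<oplus> (\<Oplus>k\<in>{1..n}. s i k j \<otimes> B (i, k) \<otimes> C (k, j))"
      using A B C ij by (intro finsum_addf) (auto intro!: mult_term_closed)
    finally show "((A \<oplus>\<^bsub>K\<^esub> B) \<otimes>\<^bsub>K\<^esub> C) (i, j) = (A \<otimes>\<^bsub>K\<^esub> C \<oplus>\<^bsub>K\<^esub> B \<otimes>\<^bsub>K\<^esub> C) (i, j)"
      unfolding add_entry[OF ij] mult_entry[OF ij] .
  qed (auto intro!: K_mult_closed K_add_closed A B C)
  show "C \<otimes>\<^bsub>K\<^esub> (A \<oplus>\<^bsub>K\<^esub> B) = C \<otimes>\<^bsub>K\<^esub> A \<oplus>\<^bsub>K\<^esub> C \<otimes>\<^bsub>K\<^esub> B"
  proof (rule matrix_eqI)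
    fix i j assume ij: "i \<in> {1..n}" "j \<in> {1..n}"
    have "(C \<otimes>\<^bsub>K\<^esub> (A \<oplus>\<^bsub>K\<^esub> B)) (i, j) =
        (\<Oplus>k\<in>{1..n}. s i k j \<otimes> C (i, k) \<otimes> A (k, j) \<oplus> s i k j \<otimes> C (i, k) \<otimes> B (k, j))"
      unfolding mult_entry[OF ij] using A B C ij
      by (intro finsum_cong') (auto simp: add_entry r_distr l_distr multiplier_closed)
    also have "\<dots> = (\<Oplus>k\<in>{1..n}. s i k j \<otimes> C (i, k) \<otimes> A (k, j))
        \<oplus> (\<Oplus>k\<in>{1..n}. s i k j \<otimes> C (i, k) \<otimes> B (k, j))"
      using A B C ij by (intro finsum_addf) (auto intro!: mult_term_closed)
    finally show "(C \<otimes>\<^bsub>K\<^esub> (A \<oplus>\<^bsub>K\<^esub> B)) (i, j) = (C \<otimes>\<^bsub>K\<^esub> A \<oplus>\<^bsub>K\<^esub> C \<otimes>\<^bsub>K\<^esub> B) (i, j)"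
      unfolding add_entry[OF ij] mult_entry[OF ij] .
  qed (auto intro!: K_mult_closed K_add_closed A B C)
qed

end

end

section \<open>The prime radical\<close>

lemma (in ring) ideal_of_closure:
  assumes "I \<subseteq> carrier R" "\<zero> \<in> I"
    and add: "\<And>x y. x \<in> I \<Longrightarrow> y \<in> I \<Longrightarrow> x \<oplus> y \<in> I"
    and l: "\<And>x r. x \<in> I \<Longrightarrow> r \<in> carrier R \<Longrightarrow> r \<otimes> x \<in> I"
    and r: "\<And>x r. x \<in> I \<Longrightarrow> r \<in> carrier R \<Longrightarrow> x \<otimes> r \<in> I"
  shows "ideal I R"
proof (rule idealI)
  have "\<ominus> x \<in> I" if "x \<in> I" for x
    using l[OF that, of "\<ominus> \<one>"] assms(1) that by (auto simp: l_minus)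
  then show "subgroup I (add_monoid R)"
    using assms(1,2) add by (intro subgroup.intro) (auto simp: a_inv_def)
qed (use l r ring_axioms in auto)

text \<open>
  Sandwiches \<open>a \<otimes> x \<otimes> b\<close> are easier to transport along homomorphisms and into corners of matrix
  rings than products of ideals. If all sandwiches of \<open>a\<close> and \<open>b\<close> lie in \<open>P\<close>, then the elements
  that behave like \<open>b\<close> in this respect form an ideal \<open>J\<close>, those that behave like \<open>a\<close> against all
  of \<open>J\<close> form an ideal \<open>I\<close>, and the product of \<open>I\<close> and \<open>J\<close> lies in \<open>P\<close>.
\<close>

lemma (in ring) nc_prime_ideal_iff_elementwise:
  "nc_prime_ideal R P \<longleftrightarrow> ideal P R \<and> P \<noteq> carrier R \<and>
    (\<forall>a\<in>carrier R. \<forall>b\<in>carrier R. (\<forall>x\<in>carrier R. a \<otimes> x \<otimes> b \<in> P) \<longrightarrow> a \<in> P \<or> b \<in> P)"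
  (is "_ \<longleftrightarrow> ?elem")
proof
  assume prime: "nc_prime_ideal R P"
  then interpret P: ideal P R unfolding nc_prime_ideal_def by simp
  have "a \<in> P \<or> b \<in> P" if a: "a \<in> carrier R" and b: "b \<in> carrier R"
    and ab: "\<And>x. x \<in> carrier R \<Longrightarrow> a \<otimes> x \<otimes> b \<in> P" for a b
  proof -
    define J where "J = {y \<in> carrier R. \<forall>x\<in>carrier R. a \<otimes> x \<otimes> y \<in> P}"
    define I where "I = {z \<in> carrier R. \<forall>y\<in>J. \<forall>x\<in>carrier R. z \<otimes> x \<otimes> y \<in> P}"
    have J: "ideal J R"
    proof (rule ideal_of_closure)
      fix y r assume y: "y \<in> J" and r: "r \<in> carrier R"
      have "a \<otimes> x \<otimes> (r \<otimes> y) \<in> P" "a \<otimes> x \<otimes> (y \<otimes> r) \<in> P" if x: "x \<in> carrier R" for x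
      proof -
        have "a \<otimes> (x \<otimes> r) \<otimes> y \<in> P" "a \<otimes> x \<otimes> y \<otimes> r \<in> P"
          using x y r unfolding J_def by (auto intro: P.I_r_closed)
        then show "a \<otimes> x \<otimes> (r \<otimes> y) \<in> P" "a \<otimes> x \<otimes> (y \<otimes> r) \<in> P"
          using x y r a unfolding J_def by (auto simp: m_assoc)
      qed
      then show "r \<otimes> y \<in> J" "y \<otimes> r \<in> J" using y r unfolding J_def by auto
    qed (use a in \<open>auto simp: J_def r_distr intro: P.a_closed\<close>)
    have Jc: "J \<subseteq> carrier R" unfolding J_def by auto
    have I: "ideal I R"
    proof (rule ideal_of_closure)
      fix z r assume z: "z \<in> I" and r: "r \<in> carrier R"
      have "(r \<otimes> z) \<otimes> x \<otimes> y \<in> P" "(z \<otimes> r) \<otimes> x \<otimes> y \<in> P"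
        if x: "x \<in> carrier R" and y: "y \<in> J" for x y
      proof -
        have "r \<otimes> (z \<otimes> x \<otimes> y) \<in> P" "z \<otimes> (r \<otimes> x) \<otimes> y \<in> P"
          using x y z r unfolding I_def by (auto intro: P.I_l_closed)
        then show "(r \<otimes> z) \<otimes> x \<otimes> y \<in> P" "(z \<otimes> r) \<otimes> x \<otimes> y \<in> P"
          using x subsetD[OF Jc y] z r unfolding I_def by (auto simp: m_assoc)
      qed
      then show "r \<otimes> z \<in> I" "z \<otimes> r \<in> I" using z r unfolding I_def by auto
    qed (use Jc in \<open>auto simp: I_def l_distr subset_iff intro: P.a_closed\<close>)
    have "ideal_prod R I J \<subseteq> P"
    proof
      fix x assume "x \<in> ideal_prod R I J"
      then show "x \<in> P"
      proof induction
        case (prod z y)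
        then have "z \<otimes> \<one> \<otimes> y \<in> P" "z \<in> carrier R" unfolding I_def by blast+
        then show ?case by simp
      qed (rule P.a_closed)
    qed
    then have "I \<subseteq> P \<or> J \<subseteq> P" using prime I J unfolding nc_prime_ideal_def by blast
    moreover have "b \<in> J" "a \<in> I" using a b ab unfolding I_def J_def by auto
    ultimately show ?thesis by blast
  qed
  moreover have "ideal P R" "P \<noteq> carrier R" using prime unfolding nc_prime_ideal_def by simp_all
  ultimately show ?elem by blast
next
  assume P: ?elem
  have "I \<subseteq> P \<or> J \<subseteq> P" if I: "ideal I R" and J: "ideal J R" and IJ: "ideal_prod R I J \<subseteq> P" for I J
  proof (rule ccontr)
    assume "\<not> (I \<subseteq> P \<or> J \<subseteq> P)"
    then obtain a b where ab: "a \<in> I" "a \<notin> P" "b \<in> J" "b \<notin> P" by blast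
    have "a \<otimes> x \<otimes> b \<in> P" if "x \<in> carrier R" for x
      using ideal_prod.prod[OF ideal.I_r_closed[OF I ab(1) that] ab(3)] IJ by blast
    then have "a \<in> P \<or> b \<in> P" using P ideal.Icarr[OF I ab(1)] ideal.Icarr[OF J ab(3)] by simp
    then show False using ab by simp
  qed
  then show "nc_prime_ideal R P" using P unfolding nc_prime_ideal_def by blast
qed

lemma (in ring) prime_radical_ideal: "ideal (prime_radical R) R"
proof (rule ideal_of_closure)
  fix x y r assume x: "x \<in> prime_radical R"
  { assume "y \<in> prime_radical R"
    then show "x \<oplus> y \<in> prime_radical R"
      using x unfolding prime_radical_def nc_prime_ideal_def
      by (auto intro: additive_subgroup.a_closed ideal.axioms(1)) }
  assume r: "r \<in> carrier R"
  show "r \<otimes> x \<in> prime_radical R" "x \<otimes> r \<in> prime_radical R"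
    using x r unfolding prime_radical_def nc_prime_ideal_def
    by (auto intro: ideal.I_l_closed ideal.I_r_closed)
qed (auto simp: prime_radical_def nc_prime_ideal_def additive_subgroup.zero_closed ideal.axioms(1))

lemma prime_radical_ring_iso:
  assumes K: "ring K" and L: "ring L" and \<phi>: "\<phi> \<in> ring_iso K L" and x: "x \<in> prime_radical K"
  shows "\<phi> x \<in> prime_radical L"
proof -
  interpret K: ring K by fact
  interpret L: ring L by fact
  have hom: "\<phi> \<in> ring_hom K L" and surj: "\<phi> ` carrier K = carrier L"
    using \<phi> by (auto simp: ring_iso_def bij_betw_def)
  interpret \<phi>: ring_hom_ring K L \<phi> using ring_hom_ringI2[OF K L hom] .
  have xK: "x \<in> carrier K" using x by (simp add: prime_radical_def)
  have "\<phi> x \<in> Q" if Q: "nc_prime_ideal L Q" for Q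
  proof -
    let ?P = "{r \<in> carrier K. \<phi> r \<in> Q}"
    have Q': "ideal Q L" "Q \<noteq> carrier L"
      "\<And>a b. \<lbrakk>a \<in> carrier L; b \<in> carrier L; \<forall>x\<in>carrier L. a \<otimes>\<^bsub>L\<^esub> x \<otimes>\<^bsub>L\<^esub> b \<in> Q\<rbrakk> \<Longrightarrow> a \<in> Q \<or> b \<in> Q"
      using Q unfolding L.nc_prime_ideal_iff_elementwise by auto
    have "nc_prime_ideal K ?P"
      unfolding K.nc_prime_ideal_iff_elementwise
    proof (intro conjI ballI impI)
      show "ideal ?P K" using \<phi>.ideal_vimage[OF Q'(1)] .
      show "?P \<noteq> carrier K" 
      proof
        assume "?P = carrier K"
        then have "carrier L \<subseteq> Q" unfolding surj[symmetric] by blast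
        then show False using Q'(2) ideal.Icarr[OF Q'(1)] by blast
      qed
      fix a b assume ab: "a \<in> carrier K" "b \<in> carrier K" "\<forall>x\<in>carrier K. a \<otimes>\<^bsub>K\<^esub> x \<otimes>\<^bsub>K\<^esub> b \<in> ?P"
      have "\<phi> a \<otimes>\<^bsub>L\<^esub> y \<otimes>\<^bsub>L\<^esub> \<phi> b \<in> Q" if "y \<in> carrier L" for y
      proof -
        obtain x where x: "x \<in> carrier K" "y = \<phi> x" using \<open>y \<in> carrier L\<close> surj by blast
        then have "\<phi> (a \<otimes>\<^bsub>K\<^esub> x \<otimes>\<^bsub>K\<^esub> b) \<in> Q" using ab(3) by blast
        then show ?thesis using ab(1,2) x by simp
      qed
      then show "a \<in> ?P \<or> b \<in> ?P" using Q'(3)[of "\<phi> a" "\<phi> b"] ab(1,2) by auto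
    qed
    then show ?thesis using x unfolding prime_radical_def by blast
  qed
  then show ?thesis using xK by (simp add: prime_radical_def)
qed

text \<open>
  Because the prime radical is an invariant of the ring, a decomposition modulo the prime radical
  can be pulled back along an isomorphism.
\<close>

lemma prime_radical_ring_iso_vimage:
  assumes K: "ring K" and L: "ring L" and \<phi>: "\<phi> \<in> ring_iso K L"
  shows "prime_radical K = {x \<in> carrier K. \<phi> x \<in> prime_radical L}"
proof -
  have "x \<in> prime_radical K" if x: "x \<in> carrier K" "\<phi> x \<in> prime_radical L" for x
  proof -
    have "inv_into (carrier K) \<phi> (\<phi> x) \<in> prime_radical K"
      using prime_radical_ring_iso[OF L K ring_iso_set_sym[OF K \<phi>] x(2)] .
    then show ?thesis using x(1) \<phi> by (simp add: ring_iso_def bij_betw_def inv_into_f_f)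
  qed
  then show ?thesis
    using prime_radical_ring_iso[OF K L \<phi>] by (auto simp: prime_radical_def[of K])
qed

section \<open>Matrices with a single non-zero entry\<close>

context formal_matrices
begin

context
  notes [simp del] = atLeastAtMost_iff One_nat_def
begin

definition single :: "nat \<Rightarrow> nat \<Rightarrow> 'a \<Rightarrow> nat \<times> nat \<Rightarrow> 'a" where
  "single i j a = (\<lambda>(p, q)\<in>{1..n} \<times> {1..n}. if p = i \<and> q = j then a else \<zero>)"

lemma single_closed: "a \<in> carrier R \<Longrightarrow> single i j a \<in> carrier K"
  by (auto simp: single_def carrier_K)

lemma single_entry:
  "\<lbrakk>p \<in> {1..n}; q \<in> {1..n}\<rbrakk> \<Longrightarrow> single i j a (p, q) = (if p = i \<and> q = j then a else \<zero>)"
  by (simp add: single_def)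

lemma single_mult:
  assumes "i \<in> {1..n}" "j \<in> {1..n}" "p \<in> {1..n}" "q \<in> {1..n}" "a \<in> carrier R" "B \<in> carrier K"
  shows "(single i j a \<otimes>\<^bsub>K\<^esub> B) (p, q) = (if p = i then s i j q \<otimes> a \<otimes> B (j, q) else \<zero>)"
proof (cases "p = i")
  case True
  then show ?thesis unfolding mult_entry[OF assms(3,4)] using assms
    by (subst finsum_eq_single[of _ j]) (auto simp: single_entry multiplier_closed)
next
  case False
  then have "(single i j a \<otimes>\<^bsub>K\<^esub> B) (p, q) = (\<Oplus>k\<in>{1..n}. \<zero>)"
    unfolding mult_entry[OF assms(3,4)] using assms
    by (intro finsum_cong') (auto simp: single_entry multiplier_closed)
  then show ?thesis using False by (simp add: finsum_zero)
qed

lemma mult_single: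
  assumes "i \<in> {1..n}" "j \<in> {1..n}" "p \<in> {1..n}" "q \<in> {1..n}" "b \<in> carrier R" "A \<in> carrier K"
  shows "(A \<otimes>\<^bsub>K\<^esub> single i j b) (p, q) = (if q = j then s p i j \<otimes> A (p, i) \<otimes> b else \<zero>)"
proof (cases "q = j")
  case True
  then show ?thesis unfolding mult_entry[OF assms(3,4)] using assms
    by (subst finsum_eq_single[of _ i]) (auto simp: single_entry multiplier_closed)
next
  case False
  then have "(A \<otimes>\<^bsub>K\<^esub> single i j b) (p, q) = (\<Oplus>k\<in>{1..n}. \<zero>)"
    unfolding mult_entry[OF assms(3,4)] using assms
    by (intro finsum_cong') (auto simp: single_entry multiplier_closed)
  then show ?thesis using False by (simp add: finsum_zero)
qed

text \<open>
  A sandwich of two one-entry matrices isolates an entry of the middle factor. Testing primeness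
  on such sandwiches reduces statements about ideals of the matrix ring to ideals of \<open>R\<close>.
\<close>

lemma single_mult_single:
  assumes "i \<in> {1..n}" "j \<in> {1..n}" "k \<in> {1..n}" "l \<in> {1..n}"
    "a \<in> carrier R" "b \<in> carrier R" "B \<in> carrier K"
  shows "single i j a \<otimes>\<^bsub>K\<^esub> B \<otimes>\<^bsub>K\<^esub> single k l b
    = single i l (s i k l \<otimes> (s i j k \<otimes> a \<otimes> B (j, k)) \<otimes> b)"
proof (rule matrix_eqI)
  fix p q assume pq: "p \<in> {1..n}" "q \<in> {1..n}"
  show "(single i j a \<otimes>\<^bsub>K\<^esub> B \<otimes>\<^bsub>K\<^esub> single k l b) (p, q)
      = single i l (s i k l \<otimes> (s i j k \<otimes> a \<otimes> B (j, k)) \<otimes> b) (p, q)"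
    using assms pq
    by (subst mult_single) (auto simp: single_closed single_entry single_mult multiplier_closed intro!: K_mult_closed)
qed (use assms in \<open>auto intro!: K_mult_closed single_closed m_closed multiplier_closed\<close>)

lemma single_mult_single_adjacent:
  assumes "i \<in> {1..n}" "j \<in> {1..n}" "k \<in> {1..n}" "a \<in> carrier R" "b \<in> carrier R"
  shows "single i j a \<otimes>\<^bsub>K\<^esub> single j k b = single i k (s i j k \<otimes> a \<otimes> b)"
  using assms
  by (intro matrix_eqI K_mult_closed single_closed m_closed multiplier_closed)
    (auto simp: single_mult single_entry single_closed multiplier_closed)

lemma single_zero: "single i j \<zero> = \<zero>\<^bsub>K\<^esub>"
  by (intro matrix_eqI K_zero_closed single_closed) (auto simp: single_entry zero_entry)

lemma mem_ideal_if_entries: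
  assumes Q: "ideal Q K" and A: "A \<in> carrier K"
    and single: "\<And>i j. \<lbrakk>i \<in> {1..n}; j \<in> {1..n}\<rbrakk> \<Longrightarrow> single i j (A (i, j)) \<in> Q"
  shows "A \<in> Q"
proof -
  interpret Q: ideal Q K by fact
  have "A \<in> Q"
    if "finite X" "A \<in> carrier K" "X \<subseteq> {1..n} \<times> {1..n}" "\<And>x. x \<in> {1..n} \<times> {1..n} - X \<Longrightarrow> A x = \<zero>"
      "\<And>i j. \<lbrakk>i \<in> {1..n}; j \<in> {1..n}\<rbrakk> \<Longrightarrow> single i j (A (i, j)) \<in> Q" for X A
    using that
  proof (induction X arbitrary: A rule: finite_induct)
    case empty
    then have "A = \<zero>\<^bsub>K\<^esub>" by (intro matrix_eqI K_zero_closed) (auto simp: zero_entry)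
    then show ?case by simp
  next
    case (insert x X)
    obtain i j where x: "x = (i, j)" "i \<in> {1..n}" "j \<in> {1..n}" using insert.prems(2) by (cases x) auto
    \<comment> \<open>Removing the entry at position \<open>x\<close> shrinks the support.\<close>
    define B where "B = (\<lambda>y\<in>{1..n} \<times> {1..n}. if y = x then \<zero> else A y)"
    have B: "B \<in> carrier K" using insert.prems(1) by (auto simp: B_def carrier_K)
    have "B \<in> Q"
    proof (rule insert.IH[OF B])
      fix p q assume pq: "p \<in> {1..n}" "q \<in> {1..n}"
      show "single p q (B (p, q)) \<in> Q"
        using insert.prems(4)[OF pq] pq by (auto simp: B_def single_zero)
    qed (use insert.prems in \<open>auto simp: B_def\<close>)
    moreover have "A = B \<oplus>\<^bsub>K\<^esub> single i j (A (i, j))"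
      using insert.prems(1) B x
      by (intro matrix_eqI K_add_closed single_closed)
        (auto simp: add_entry single_entry B_def)
    ultimately show ?case using insert.prems(4)[OF x(2,3)]
        additive_subgroup.a_closed[OF ideal.axioms(1)[OF Q]] by metis
  qed
  from this[of "{1..n} \<times> {1..n}" A] show ?thesis using A single by auto
qed

section \<open>Indecomposability\<close>

text \<open>
  The comparisons with one-entry matrices that force a central matrix to be scalar only involve
  multipliers of the form \<open>s i i k\<close> or \<open>s i k k\<close>, which are one. So the centre is that of an
  ordinary matrix ring.
\<close>

lemma center_scalar:
  assumes X: "X \<in> ring_center K" and ij: "i \<in> {1..n}" "j \<in> {1..n}"
  shows "X (i, j) = (if i = j then X (1, 1) else \<zero>)" and "X (i, i) \<in> ring_center R"
proof -
  have XK: "X \<in> carrier K" using X(1) unfolding ring_center_def by blast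
  have comm: "(X \<otimes>\<^bsub>K\<^esub> single k l a) (p, q) = (single k l a \<otimes>\<^bsub>K\<^esub> X) (p, q)"
    if "a \<in> carrier R" for k l a p q
    using X single_closed[OF that] by (simp add: ring_center_def)
  have diag: "X (k, k) \<otimes> a = a \<otimes> X (l, l)" if "k \<in> {1..n}" "l \<in> {1..n}" "a \<in> carrier R" for k l a
    using comm[OF that(3), of k l k l] that XK
    by (simp add: single_mult mult_single multiplier_left multiplier_right)
  show "X (i, i) \<in> ring_center R"
    using diag[OF ij(1) ij(1)] XK ij by (simp add: ring_center_def)
  have "1 \<in> {1..n}" using ij by (simp add: atLeastAtMost_iff)
  then have "X (i, i) = X (1, 1)" using diag[of i 1 \<one>] ij XK by simp
  moreover have "X (i, j) = \<zero>" if "i \<noteq> j"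
    using comm[OF one_closed, of j j i j] that ij XK
    by (simp add: single_mult mult_single multiplier_right)
  ultimately show "X (i, j) = (if i = j then X (1, 1) else \<zero>)" by auto
qed

lemma indecomposable_K:
  assumes R: "indecomposable_ring R" and n: "0 < n"
  shows "indecomposable_ring K"
proof -
  interpret K: ring K by (rule ring_K)
  have one: "1 \<in> {1..n}" using n by (simp add: atLeastAtMost_iff)
  have "X \<in> {\<zero>\<^bsub>K\<^esub>, \<one>\<^bsub>K\<^esub>}" if X: "X \<in> ring_center K" "X \<otimes>\<^bsub>K\<^esub> X = X" for X
  proof -
    have XK: "X \<in> carrier K" using X(1) unfolding ring_center_def by blast
    note scalar = center_scalar(1)[OF X(1)]
    have "X (1, 1) = (\<Oplus>k\<in>{1..n}. s 1 k 1 \<otimes> X (1, k) \<otimes> X (k, 1))"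
      using mult_entry[OF one one, of X X] unfolding X(2) .
    also have "\<dots> = X (1, 1) \<otimes> X (1, 1)"
    proof (subst finsum_eq_single[of _ 1])
      fix k assume k: "k \<in> {1..n}" "k \<noteq> 1"
      then show "s 1 k 1 \<otimes> X (1, k) \<otimes> X (k, 1) = \<zero>"
        using one XK scalar[OF one k(1)] by (simp add: multiplier_closed)
    qed (use one XK in \<open>auto simp: multiplier_left\<close>)
    finally have "X (1, 1) \<otimes> X (1, 1) = X (1, 1)" by (rule sym)
    then have "X (1, 1) \<in> {\<zero>, \<one>}"
      using R center_scalar(2)[OF X(1) one one] unfolding indecomposable_ring_def by blast
    then show ?thesis
    proof (elim insertE emptyE)
      assume "X (1, 1) = \<zero>"
      then have "X = \<zero>\<^bsub>K\<^esub>" using XK scalar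
        by (intro matrix_eqI K_zero_closed) (metis zero_entry)+
      then show ?thesis by simp
    next
      assume "X (1, 1) = \<one>"
      then have "X = \<one>\<^bsub>K\<^esub>" using XK scalar
        by (intro matrix_eqI K_one_closed) (metis one_entry)+
      then show ?thesis by simp
    qed
  qed
  then have "{e \<in> ring_center K. e \<otimes>\<^bsub>K\<^esub> e = e} \<subseteq> {\<zero>\<^bsub>K\<^esub>, \<one>\<^bsub>K\<^esub>}" by blast
  moreover have "\<zero>\<^bsub>K\<^esub> \<in> ring_center K" "\<one>\<^bsub>K\<^esub> \<in> ring_center K"
    by (simp_all add: ring_center_def)
  ultimately show ?thesis unfolding indecomposable_ring_def by auto
qed

end

end

lemma formal_matrices_ones: "ring S \<Longrightarrow> formal_matrices S m (\<lambda>_ _ _. \<one>\<^bsub>S\<^esub>)"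
  unfolding formal_matrices_def formal_matrices_axioms_def multiplier_system_def ring_center_def
  by (auto simp: ring.is_monoid monoid.l_one monoid.r_one)

text \<open>
  Ordinary matrix rings are formal matrix rings with all multipliers one; the two multiplications
  are compared on the carrier, where the factors \<open>\<one>\<close> can be cancelled.
\<close>

lemma matrix_ring_as_formal:
  assumes "ring S"
  shows "carrier (matrix_ring m S) = carrier (formal_matrix_ring m S (\<lambda>_ _ _. \<one>\<^bsub>S\<^esub>))"
    and "zero (matrix_ring m S) = zero (formal_matrix_ring m S (\<lambda>_ _ _. \<one>\<^bsub>S\<^esub>))"
    and "one (matrix_ring m S) = one (formal_matrix_ring m S (\<lambda>_ _ _. \<one>\<^bsub>S\<^esub>))"
    and "add (matrix_ring m S) = add (formal_matrix_ring m S (\<lambda>_ _ _. \<one>\<^bsub>S\<^esub>))"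
    and "\<lbrakk>A \<in> carrier (matrix_ring m S); B \<in> carrier (matrix_ring m S)\<rbrakk> \<Longrightarrow>
      A \<otimes>\<^bsub>matrix_ring m S\<^esub> B = A \<otimes>\<^bsub>formal_matrix_ring m S (\<lambda>_ _ _. \<one>\<^bsub>S\<^esub>)\<^esub> B"
proof -
  interpret ring S by fact
  show "A \<otimes>\<^bsub>matrix_ring m S\<^esub> B = A \<otimes>\<^bsub>formal_matrix_ring m S (\<lambda>_ _ _. \<one>\<^bsub>S\<^esub>)\<^esub> B"
    if "A \<in> carrier (matrix_ring m S)" "B \<in> carrier (matrix_ring m S)"
    using that unfolding matrix_ring_def formal_matrix_ring_def
    by (auto intro!: restrict_ext finsum_cong' l_one[symmetric] arg_cong2[where f = "mult S"])
qed (auto simp: matrix_ring_def formal_matrix_ring_def)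

lemma ring_matrix_ring:
  assumes "ring S"
  shows "ring (matrix_ring m S)"
proof -
  interpret F: formal_matrices S m "\<lambda>_ _ _. \<one>\<^bsub>S\<^esub>" by (rule formal_matrices_ones[OF assms])
  have "id \<in> ring_hom F.K (matrix_ring m S)"
    by (rule ring_hom_memI) (auto simp: matrix_ring_as_formal[OF assms])
  from ring.ring_hom_imp_img_ring[OF F.ring_K this]
  show ?thesis by (simp flip: matrix_ring_as_formal[OF assms])
qed

lemma indecomposable_matrix_ring:
  assumes "ring S" "indecomposable_ring S" "0 < m"
  shows "indecomposable_ring (matrix_ring m S)"
proof -
  interpret F: formal_matrices S m "\<lambda>_ _ _. \<one>\<^bsub>S\<^esub>" by (rule formal_matrices_ones[OF assms(1)])
  have "{e \<in> ring_center (matrix_ring m S). e \<otimes>\<^bsub>matrix_ring m S\<^esub> e = e}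
      = {e \<in> ring_center F.K. e \<otimes>\<^bsub>F.K\<^esub> e = e}"
    unfolding ring_center_def by (auto simp: matrix_ring_as_formal[OF assms(1)])
  then show ?thesis
    using F.indecomposable_K[OF assms(2,3)] unfolding indecomposable_ring_def
    by (simp add: matrix_ring_as_formal[OF assms(1)])
qed

section \<open>Uniqueness of decompositions into indecomposable factors\<close>

text \<open>
  For finite \<open>I\<close> this says that the factor ring of \<open>K\<close> by \<open>N\<close> is a product of non-zero
  indecomposable rings \<open>M C\<close>, expressed through the projections \<open>h C\<close> with source \<open>K\<close> itself:
  they are onto, they jointly vanish exactly on \<open>N\<close>, and for each factor some element projects to
  its identity and to zero elsewhere.
  Two decompositions of one factor ring are then two families of maps on \<open>K\<close>, which can be
  compared by applying the maps of one family to the idempotents of the other.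
\<close>

locale indecomposable_splitting = ring K for K (structure) +
  fixes I :: "'i set" and M :: "'i \<Rightarrow> ('c, 'd) ring_scheme" and h :: "'i \<Rightarrow> 'a \<Rightarrow> 'c" and N :: "'a set"
  assumes hom: "C \<in> I \<Longrightarrow> ring_hom_ring K (M C) (h C)"
    and surj: "C \<in> I \<Longrightarrow> h C ` carrier K = carrier (M C)"
    and indec: "C \<in> I \<Longrightarrow> indecomposable_ring (M C)"
    and nontriv: "C \<in> I \<Longrightarrow> \<one>\<^bsub>M C\<^esub> \<noteq> \<zero>\<^bsub>M C\<^esub>"
    and kernel: "N = {x \<in> carrier K. \<forall>C\<in>I. h C x = \<zero>\<^bsub>M C\<^esub>}"
    and split: "C \<in> I \<Longrightarrow>
      \<exists>e\<in>carrier K. h C e = \<one>\<^bsub>M C\<^esub> \<and> (\<forall>D\<in>I - {C}. h D e = \<zero>\<^bsub>M D\<^esub>)"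
begin

definition idem :: "'i \<Rightarrow> 'a" where
  "idem C = (SOME x. x \<in> carrier K \<and> h C x = \<one>\<^bsub>M C\<^esub> \<and> (\<forall>D\<in>I - {C}. h D x = \<zero>\<^bsub>M D\<^esub>))"

lemma idem:
  assumes "C \<in> I"
  shows "idem C \<in> carrier K" "h C (idem C) = \<one>\<^bsub>M C\<^esub>"
    and "\<lbrakk>D \<in> I; D \<noteq> C\<rbrakk> \<Longrightarrow> h D (idem C) = \<zero>\<^bsub>M D\<^esub>"
proof -
  have "idem C \<in> carrier K \<and> h C (idem C) = \<one>\<^bsub>M C\<^esub> \<and> (\<forall>D\<in>I - {C}. h D (idem C) = \<zero>\<^bsub>M D\<^esub>)"
    unfolding idem_def by (rule someI_ex) (use split[OF assms] in blast)
  then show "idem C \<in> carrier K" "h C (idem C) = \<one>\<^bsub>M C\<^esub>"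
    and "\<lbrakk>D \<in> I; D \<noteq> C\<rbrakk> \<Longrightarrow> h D (idem C) = \<zero>\<^bsub>M D\<^esub>" by blast+
qed

text \<open>
  Whether two elements have the same projections depends on \<open>N\<close> only, hence an identity verified
  with one family of projections holds for every family with the same joint kernel.
\<close>

lemma components_eq_iff:
  assumes "x \<in> carrier K" "y \<in> carrier K"
  shows "(\<forall>C\<in>I. h C x = h C y) \<longleftrightarrow> x \<ominus> y \<in> N"
proof -
  have "h C x = h C y \<longleftrightarrow> h C (x \<ominus> y) = \<zero>\<^bsub>M C\<^esub>" if "C \<in> I" for C
  proof -
    interpret h: ring_hom_ring K "M C" "h C" by (rule hom[OF that])
    have "h C (x \<ominus> y) = h C x \<ominus>\<^bsub>M C\<^esub> h C y" using assms by (simp add: a_minus_def)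
    moreover have "h C x \<ominus>\<^bsub>M C\<^esub> h C y = \<zero>\<^bsub>M C\<^esub> \<longleftrightarrow> h C x = h C y"
      using assms h.S.minus_equality[of "h C x" "\<ominus>\<^bsub>M C\<^esub> h C y"]
      by (auto simp: a_minus_def h.S.r_neg)
    ultimately show ?thesis by simp
  qed
  then show ?thesis unfolding kernel using assms by auto
qed

lemma hom_mult: "\<lbrakk>C \<in> I; x \<in> carrier K; y \<in> carrier K\<rbrakk> \<Longrightarrow> h C (x \<otimes> y) = h C x \<otimes>\<^bsub>M C\<^esub> h C y"
  using hom ring_hom_ring.homh ring_hom_mult by metis

lemma hom_closed: "\<lbrakk>C \<in> I; x \<in> carrier K\<rbrakk> \<Longrightarrow> h C x \<in> carrier (M C)"
  using surj by blast

lemma ring_M: "C \<in> I \<Longrightarrow> ring (M C)"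
  using hom ring_hom_ring.axioms(2) by blast

lemma hom_zero:
  assumes "C \<in> I"
  shows "h C \<zero> = \<zero>\<^bsub>M C\<^esub>"
proof -
  interpret h: ring_hom_ring K "M C" "h C" by (rule hom[OF assms])
  show ?thesis by simp
qed

lemma idem_mult:
  assumes "C \<in> I" "D \<in> I" "x \<in> carrier K"
  shows "h D (idem C \<otimes> x) = (if D = C then h D x else \<zero>\<^bsub>M D\<^esub>)"
    and "h D (x \<otimes> idem C) = (if D = C then h D x else \<zero>\<^bsub>M D\<^esub>)"
proof -
  interpret h: ring_hom_ring K "M D" "h D" by (rule hom[OF assms(2)])
  show "h D (idem C \<otimes> x) = (if D = C then h D x else \<zero>\<^bsub>M D\<^esub>)"
    "h D (x \<otimes> idem C) = (if D = C then h D x else \<zero>\<^bsub>M D\<^esub>)"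
  proof (atomize (full), cases "D = C")
    case True
    have "h D (idem C) = \<one>\<^bsub>M D\<^esub>" using idem(2)[OF assms(1)] unfolding True .
    then show "h D (idem C \<otimes> x) = (if D = C then h D x else \<zero>\<^bsub>M D\<^esub>)
        \<and> h D (x \<otimes> idem C) = (if D = C then h D x else \<zero>\<^bsub>M D\<^esub>)"
      unfolding if_P[OF True] using idem(1)[OF assms(1)] assms(3) by simp
  next
    case False
    then show "h D (idem C \<otimes> x) = (if D = C then h D x else \<zero>\<^bsub>M D\<^esub>)
        \<and> h D (x \<otimes> idem C) = (if D = C then h D x else \<zero>\<^bsub>M D\<^esub>)"
      using idem[OF assms(1)] assms(2,3) by simp
  qed
qed

lemma pull_back_iso:
  assumes L: "ring L" and \<phi>: "\<phi> \<in> ring_iso L K"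
  shows "indecomposable_splitting L I M (\<lambda>C. h C \<circ> \<phi>) {x \<in> carrier L. \<phi> x \<in> N}"
proof -
  interpret L: ring L by fact
  have \<phi>hom: "\<phi> \<in> ring_hom L K" and \<phi>surj: "\<phi> ` carrier L = carrier K"
    using \<phi> by (auto simp: ring_iso_def bij_betw_def)
  have \<phi>c: "\<phi> x \<in> carrier K" if "x \<in> carrier L" for x using that \<phi>surj by blast
  show ?thesis
  proof (intro indecomposable_splitting.intro indecomposable_splitting_axioms.intro)
    fix C assume C: "C \<in> I"
    have "h C \<in> ring_hom K (M C)" using hom[OF C] ring_hom_ring.homh by blast
    then show "ring_hom_ring L (M C) (h C \<circ> \<phi>)"
      by (intro ring_hom_ringI2 L ring_M C ring_hom_trans[OF \<phi>hom])
    show "(h C \<circ> \<phi>) ` carrier L = carrier (M C)"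
      unfolding image_comp[symmetric] \<phi>surj by (rule surj[OF C])
    have "idem C \<in> \<phi> ` carrier L" using idem(1)[OF C] \<phi>surj by simp
    then obtain x where "x \<in> carrier L" "idem C = \<phi> x" by (elim imageE)
    then show "\<exists>x\<in>carrier L. (h C \<circ> \<phi>) x = \<one>\<^bsub>M C\<^esub> \<and> (\<forall>D\<in>I - {C}. (h D \<circ> \<phi>) x = \<zero>\<^bsub>M D\<^esub>)"
      using idem(2,3)[OF C] by (intro bexI[of _ x]) simp_all
  qed (use L \<phi>c indec nontriv kernel in auto)
qed

end

locale two_splittings =
  A: indecomposable_splitting K I M h N + B: indecomposable_splitting K I' M' h' N
  for K (structure) and I M h N and I' M' h'
begin

lemma components_transfer:
  assumes "x \<in> carrier K" "y \<in> carrier K" "\<And>C. C \<in> I \<Longrightarrow> h C x = h C y" "D \<in> I'"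
  shows "h' D x = h' D y"
  using A.components_eq_iff[OF assms(1,2)] B.components_eq_iff[OF assms(1,2)] assms(3,4) by blast

text \<open>
  The idempotent that belongs to a factor of the first decomposition is central modulo \<open>N\<close>.
  Projected to an indecomposable factor of the second decomposition it must become \<open>\<zero>\<close> or \<open>\<one>\<close>;
  in the second case the two factors are called linked.
\<close>

lemma linked_cases:
  assumes "C \<in> I" "D \<in> I'"
  shows "h' D (A.idem C) = \<one>\<^bsub>M' D\<^esub> \<or> h' D (A.idem C) = \<zero>\<^bsub>M' D\<^esub>"
proof -
  have "h' D (A.idem C) \<otimes>\<^bsub>M' D\<^esub> y = y \<otimes>\<^bsub>M' D\<^esub> h' D (A.idem C)" if y: "y \<in> carrier (M' D)" for y
  proof -
    obtain x where x: "x \<in> carrier K" "y = h' D x" using y B.surj[OF assms(2)] by blast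
    have "h' D (A.idem C \<otimes> x) = h' D (x \<otimes> A.idem C)"
      using assms x A.idem by (intro components_transfer) (auto simp: A.idem_mult)
    then show ?thesis using assms x A.idem(1) by (simp add: B.hom_mult)
  qed
  moreover have "h' D (A.idem C \<otimes> A.idem C) = h' D (A.idem C)"
    using assms A.idem by (intro components_transfer) (auto simp: A.idem_mult)
  then have "h' D (A.idem C) \<otimes>\<^bsub>M' D\<^esub> h' D (A.idem C) = h' D (A.idem C)"
    unfolding B.hom_mult[OF assms(2) A.idem(1)[OF assms(1)] A.idem(1)[OF assms(1)]] .
  moreover have "h' D (A.idem C) \<in> carrier (M' D)" using B.hom_closed[OF assms(2) A.idem(1)[OF assms(1)]] .
  ultimately have "h' D (A.idem C) \<in> {z \<in> ring_center (M' D). z \<otimes>\<^bsub>M' D\<^esub> z = z}"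
    unfolding ring_center_def by blast
  then show ?thesis using B.indec[OF assms(2)] unfolding indecomposable_ring_def by blast
qed

text \<open>
  If \<open>x\<close> vanishes in the factor \<open>C\<close>, then \<open>idem C \<otimes> x\<close> vanishes in all factors, so it lies in
  \<open>N\<close>; in a factor linked to \<open>C\<close> the multiplication by \<open>idem C\<close> is invisible.
\<close>

lemma kernel_transfer:
  assumes "C \<in> I" "D \<in> I'" "h' D (A.idem C) = \<one>\<^bsub>M' D\<^esub>" "x \<in> carrier K" "h C x = \<zero>\<^bsub>M C\<^esub>"
  shows "h' D x = \<zero>\<^bsub>M' D\<^esub>"
proof -
  have "h' D (A.idem C \<otimes> x) = h' D \<zero>"
    using assms A.idem by (intro components_transfer) (auto simp: A.hom_zero A.idem_mult)
  moreover have "h' D (A.idem C \<otimes> x) = \<one>\<^bsub>M' D\<^esub> \<otimes>\<^bsub>M' D\<^esub> h' D x"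
    using assms A.idem(1) by (simp add: B.hom_mult)
  ultimately show ?thesis
    using assms B.hom_zero B.hom_closed B.ring_M monoid.l_one ring.is_monoid by metis
qed

text \<open>
  An idempotent that vanished in all factors of the second decomposition would lie in \<open>N\<close>.
\<close>

lemma ex_linked:
  assumes "C \<in> I"
  shows "\<exists>D\<in>I'. h' D (A.idem C) = \<one>\<^bsub>M' D\<^esub>"
proof (rule ccontr)
  assume "\<not> ?thesis"
  then have "\<forall>D\<in>I'. h' D (A.idem C) = h' D \<zero>" using linked_cases[OF assms] B.hom_zero by metis
  then have "h C (A.idem C) = h C \<zero>"
    using A.components_eq_iff[of "A.idem C" \<zero>] B.components_eq_iff[of "A.idem C" \<zero>] A.idem(1)[OF assms] assms
    by simp
  then show False using A.idem(2) A.hom_zero A.nontriv assms by metis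
qed

text \<open>
  Idempotents of different factors are orthogonal, hence they cannot both become \<open>\<one>\<close> in \<open>D\<close>.
\<close>

lemma linked_inj:
  assumes "C \<in> I" "B \<in> I" "D \<in> I'" "h' D (A.idem C) = \<one>\<^bsub>M' D\<^esub>" "h' D (A.idem B) = \<one>\<^bsub>M' D\<^esub>"
  shows "B = C"
proof (rule ccontr)
  assume "B \<noteq> C"
  then have "h' D (A.idem B) = \<zero>\<^bsub>M' D\<^esub>"
    using assms A.idem by (intro kernel_transfer[of C]) auto
  then show False using assms B.nontriv by simp
qed

end

text \<open>
  If the idempotent of \<open>D\<close> vanished in \<open>C\<close>, it would vanish in the linked factor \<open>D\<close> as well,
  where it projects to \<open>\<one>\<close>.
\<close>

lemma (in two_splittings) linked_sym:
  assumes "C \<in> I" "D \<in> I'" "h' D (A.idem C) = \<one>\<^bsub>M' D\<^esub>"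
  shows "h C (B.idem D) = \<one>\<^bsub>M C\<^esub>"
proof (rule ccontr)
  interpret S: two_splittings K I' M' h' N I M h by unfold_locales
  assume "\<not> ?thesis"
  then have "h C (B.idem D) = \<zero>\<^bsub>M C\<^esub>" using S.linked_cases[OF assms(2,1)] by simp
  then have "h' D (B.idem D) = \<zero>\<^bsub>M' D\<^esub>" using kernel_transfer assms B.idem(1) by blast
  then show False using B.idem(2) B.nontriv assms by metis
qed

lemma ring_iso_of_same_kernel:
  assumes f: "ring_hom_ring K A f" "f ` carrier K = carrier A"
    and g: "ring_hom_ring K B g" "g ` carrier K = carrier B"
    and ker: "\<And>x. x \<in> carrier K \<Longrightarrow> f x = \<zero>\<^bsub>A\<^esub> \<longleftrightarrow> g x = \<zero>\<^bsub>B\<^esub>"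
  shows "A \<simeq> B"
proof -
  interpret f: ring_hom_ring K A f by fact
  interpret g: ring_hom_ring K B g by fact
  have "a_kernel K A f = a_kernel K B g"
    using ker unfolding a_kernel_def' by blast
  then have "K Quot a_kernel K A f \<simeq> B" using g.FactRing_iso[OF g(2)] by simp
  moreover have "A \<simeq> K Quot a_kernel K A f"
    using ring_iso_sym[OF ideal.quotient_is_ring[OF f.kernel_is_ideal] f.FactRing_iso[OF f(2)]] .
  ultimately show ?thesis using ring_iso_trans by blast
qed

text \<open>
  Decompositions into indecomposable factors are unique. Linkage is a symmetric relation that is
  total and injective in both directions, hence a bijection; linked factors are quotients of
  \<open>K\<close> by the same kernel.
\<close>

theorem (in two_splittings) components_match:
  "\<exists>g. bij_betw g I I' \<and> (\<forall>C\<in>I. M C \<simeq> M' (g C))"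
proof -
  interpret S: two_splittings K I' M' h' N I M h by unfold_locales
  let ?linked = "\<lambda>C D. h' D (A.idem C) = \<one>\<^bsub>M' D\<^esub>"
  obtain g where g: "\<And>C. C \<in> I \<Longrightarrow> g C \<in> I' \<and> ?linked C (g C)"
    using bchoice[of I "\<lambda>C D. D \<in> I' \<and> ?linked C D"] ex_linked by blast
  have "inj_on g I" using g linked_inj by (intro inj_onI) metis
  moreover have "g ` I = I'"
  proof
    show "I' \<subseteq> g ` I"
    proof
      fix D assume D: "D \<in> I'"
      then obtain C where C: "C \<in> I" "h C (B.idem D) = \<one>\<^bsub>M C\<^esub>" using S.ex_linked by blast
      have "h C (B.idem (g C)) = \<one>\<^bsub>M C\<^esub>" using linked_sym g C by blast
      then have "g C = D" using S.linked_inj[of D "g C" C] C D g by blast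
      then show "D \<in> g ` I" using C by blast
    qed
  qed (use g in blast)
  moreover have "M C \<simeq> M' (g C)" if C: "C \<in> I" for C
  proof (rule ring_iso_of_same_kernel)
    fix x assume x: "x \<in> carrier K"
    show "h C x = \<zero>\<^bsub>M C\<^esub> \<longleftrightarrow> h' (g C) x = \<zero>\<^bsub>M' (g C)\<^esub>"
      using kernel_transfer[of C "g C" x] S.kernel_transfer[of "g C" C x] linked_sym[of C "g C"]
        g[OF C] C x by blast
  qed (use g C A.hom A.surj B.hom B.surj in blast)+
  ultimately show ?thesis unfolding bij_betw_def by blast
qed

section \<open>Multipliers equal to zero or one\<close>

locale formal_matrices_01 = formal_matrices R n s for R (structure) and n s +
  assumes multiplier_01: "\<lbrakk>i \<in> {1..n}; j \<in> {1..n}; k \<in> {1..n}\<rbrakk> \<Longrightarrow> s i j k \<in> {\<zero>, \<one>}"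
    and one_neq_zero: "\<one> \<noteq> \<zero>"
begin

text \<open>
  This is an equivalence relation. The multiplier of a path \<open>i, j, k\<close> is one if one of its two
  steps joins similar indices, and zero if the path leaves a class and returns to it. The matrix ring
  therefore looks like an ordinary one inside each class, and products through other classes do
  not contribute to the diagonal blocks.
\<close>

definition sim :: "nat \<Rightarrow> nat \<Rightarrow> bool" where
  "sim i j \<longleftrightarrow> s i j i = \<one>"

definition sim_class :: "nat \<Rightarrow> nat set" where
  "sim_class i = {j \<in> {1..n}. sim i j}"

lemma sim_refl: "i \<in> {1..n} \<Longrightarrow> sim i i"
  by (simp add: sim_def multiplier_left)

lemma sim_sym: "\<lbrakk>i \<in> {1..n}; j \<in> {1..n}; sim i j\<rbrakk> \<Longrightarrow> sim j i"
  using multiplier_assoc[of i j i j] one_neq_zero multiplier_01[of j i j]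
  by (auto simp: sim_def multiplier_left multiplier_right)

lemma multiplier_eq_one_left:
  assumes "i \<in> {1..n}" "j \<in> {1..n}" "k \<in> {1..n}" "sim i j"
  shows "s i j k = \<one>"
  using multiplier_assoc[of i j i k] multiplier_01[of i j k] multiplier_01[of j i k] multiplier_closed[of j i k]
    assms one_neq_zero
  by (auto simp: sim_def multiplier_left)

lemma multiplier_eq_one_right:
  assumes "i \<in> {1..n}" "j \<in> {1..n}" "k \<in> {1..n}" "sim j k"
  shows "s i j k = \<one>"
  using multiplier_assoc[of i j k j] multiplier_01[of i j k] multiplier_01[of i k j] assms one_neq_zero
  by (auto simp: sim_def multiplier_right)

lemma multiplier_eq_zero:
  assumes "i \<in> {1..n}" "j \<in> {1..n}" "k \<in> {1..n}" "sim i j" "\<not> sim i k"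
  shows "s i k j = \<zero>"
  using multiplier_assoc[of i k j i] multiplier_01[of i k j] multiplier_01[of i k i]
    multiplier_closed[of k j i] assms one_neq_zero
  by (auto simp: sim_def)

lemma sim_trans:
  assumes "i \<in> {1..n}" "j \<in> {1..n}" "k \<in> {1..n}" "sim i j" "sim j k"
  shows "sim i k"
  using multiplier_assoc[of i j k i] multiplier_eq_one_left[of i j k] multiplier_eq_one_left[of j k i]
    multiplier_closed[of i k i] assms by (simp add: sim_def)

lemma sim_class_eq_iff:
  assumes "i \<in> {1..n}" "j \<in> {1..n}"
  shows "sim_class i = sim_class j \<longleftrightarrow> sim i j"
proof
  assume "sim_class i = sim_class j"
  then have "j \<in> sim_class i" using assms(2) sim_refl unfolding sim_class_def by blast
  then show "sim i j" by (simp add: sim_class_def)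
next
  assume ij: "sim i j"
  show "sim_class i = sim_class j"
    using assms sim_trans[OF assms(1,2) _ ij] sim_trans[OF assms(2,1) _ sim_sym[OF assms ij]]
    unfolding sim_class_def by blast
qed

lemma principal_multiplier_matrix_entry:
  assumes "i \<in> {1..n}" "j \<in> {1..n}"
  shows "principal_multiplier_matrix n s (i, j) = (if sim_class i = sim_class j then \<one> else \<zero>)"
  using assms multiplier_01[of i j i]
  by (auto simp: principal_multiplier_matrix_def sim_class_eq_iff sim_def)

text \<open>
  In the form \<open>K\<^sub>0\<close> the relation \<open>sim\<close>, that is the principal multiplier matrix, determines all
  the multipliers. The hypothesis covers distinct indices; for \<open>i = k\<close> the multiplier is itself
  an entry of the principal multiplier matrix.
\<close>

lemma K0_multiplier:
  assumes "form_K0 n R s" "i \<in> {1..n}" "j \<in> {1..n}" "k \<in> {1..n}"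
  shows "s i j k = (if sim i j \<or> sim j k then \<one> else \<zero>)"
proof (cases "sim i j \<or> sim j k")
  case True
  then show ?thesis using multiplier_eq_one_left multiplier_eq_one_right assms by auto
next
  case False
  then have ne: "i \<noteq> j" "j \<noteq> k" using sim_refl assms by auto
  have z: "s i j i = \<zero>" "s j k j = \<zero>"
    using False multiplier_01[of i j i] multiplier_01[of j k j] assms by (auto simp: sim_def)
  then have "s i j k = \<zero>"
  proof (cases "i = k")
    case False
    then show ?thesis using assms ne z unfolding form_K0_def by blast
  qed simp
  then show ?thesis using False by simp
qed

section \<open>The prime radical of a formal matrix ring\<close>

definition block_map :: "'a set \<Rightarrow> (nat \<Rightarrow> nat) \<Rightarrow> nat \<Rightarrow> (nat \<times> nat \<Rightarrow> 'a) \<Rightarrow> nat \<times> nat \<Rightarrow> 'a set" where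
  "block_map P c m A = (\<lambda>(i, j)\<in>{1..m} \<times> {1..m}. P +> A (c i, c j))"

context
  fixes P :: "'a set" and c :: "nat \<Rightarrow> nat" and m i0 :: nat
  assumes P: "ideal P R" and i0: "i0 \<in> {1..n}" and c: "bij_betw c {1..m} (sim_class i0)"
  notes [simp del] = atLeastAtMost_iff One_nat_def
begin

lemma enum_class:
  assumes "i \<in> {1..m}"
  shows "c i \<in> {1..n}" "sim i0 (c i)"
  using bij_betwE[OF c] assms by (auto simp: sim_class_def)

lemma enum_sim: "\<lbrakk>i \<in> {1..m}; j \<in> {1..m}\<rbrakk> \<Longrightarrow> sim (c i) (c j)"
  using enum_class sim_sym sim_trans i0 by meson

lemma enum_not_sim: "\<lbrakk>i \<in> {1..m}; k \<in> {1..n}; k \<notin> c ` {1..m}\<rbrakk> \<Longrightarrow> \<not> sim (c i) k"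
  using enum_class sim_trans i0 bij_betw_imp_surj_on[OF c] unfolding sim_class_def by blast

text \<open>
  Summands with an index outside the class vanish and those inside carry the multiplier one, so
  taking a diagonal block is multiplicative although it forgets all other entries.
\<close>

lemma block_mult_entry:
  assumes A: "A \<in> carrier K" and B: "B \<in> carrier K" and ij: "i \<in> {1..m}" "j \<in> {1..m}"
  shows "(A \<otimes>\<^bsub>K\<^esub> B) (c i, c j) = (\<Oplus>k\<in>{1..m}. A (c i, c k) \<otimes> B (c k, c j))"
proof -
  have sub: "c ` {1..m} \<subseteq> {1..n}" using enum_class by auto
  have "(A \<otimes>\<^bsub>K\<^esub> B) (c i, c j)
      = (\<Oplus>k\<in>{1..n}. s (c i) k (c j) \<otimes> A (c i, k) \<otimes> B (k, c j))"
    using enum_class ij by (simp add: mult_entry)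
  also have "\<dots> = (\<Oplus>k\<in>c ` {1..m}. A (c i, k) \<otimes> B (k, c j))"
  proof (rule add.finprod_mono_neutral_cong_right)
    fix k assume k: "k \<in> {1..n} - c ` {1..m}"
    then have "s (c i) k (c j) = \<zero>"
      using enum_class ij enum_sim enum_not_sim by (intro multiplier_eq_zero) auto
    then show "s (c i) k (c j) \<otimes> A (c i, k) \<otimes> B (k, c j) = \<zero>"
      using A B k enum_class ij by simp
  next
    fix k assume k: "k \<in> c ` {1..m}"
    then have "s (c i) k (c j) = \<one>"
      using enum_class ij enum_sim by (intro multiplier_eq_one_left) auto
    then show "s (c i) k (c j) \<otimes> A (c i, k) \<otimes> B (k, c j) = A (c i, k) \<otimes> B (k, c j)"
      using A B k sub enum_class ij by auto
  qed (use sub A B enum_class ij in \<open>auto intro: mult_term_closed\<close>)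
  also have "\<dots> = (\<Oplus>k\<in>{1..m}. A (c i, c k) \<otimes> B (c k, c j))"
    using A B enum_class ij bij_betw_imp_inj_on[OF c]
    by (intro finsum_reindex) auto
  finally show ?thesis .
qed

lemma carrier_block: "carrier (matrix_ring m (R Quot P)) = {1..m} \<times> {1..m} \<rightarrow>\<^sub>E a_rcosets P"
  by (simp add: matrix_ring_def FactRing_def)

lemma block_map_hom: "ring_hom_ring K (matrix_ring m (R Quot P)) (block_map P c m)"
proof -
  interpret P: ideal P R by (rule P)
  interpret Q: ring_hom_ring R "R Quot P" "(+>) P" by (rule P.rcos_ring_hom_ring)
  have closed: "P +> A (c i, c j) \<in> carrier (R Quot P)"
    if "A \<in> carrier K" "i \<in> {1..m}" "j \<in> {1..m}" for A i j
    using that enum_class by (intro Q.hom_closed) simp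
  show ?thesis
  proof (rule ring_hom_ringI2[OF ring_K ring_matrix_ring[OF P.quotient_is_ring]])
    show "block_map P c m \<in> ring_hom K (matrix_ring m (R Quot P))"
    proof (rule ring_hom_memI)
      fix A assume A: "A \<in> carrier K"
      show "block_map P c m A \<in> carrier (matrix_ring m (R Quot P))"
        using closed[OF A] by (auto simp: matrix_ring_def block_map_def)
    next
      fix A B assume A: "A \<in> carrier K" and B: "B \<in> carrier K"
      have "P +> (A \<otimes>\<^bsub>K\<^esub> B) (c i, c j)
          = (\<Oplus>\<^bsub>R Quot P\<^esub>k\<in>{1..m}. (P +> A (c i, c k)) \<otimes>\<^bsub>R Quot P\<^esub> (P +> B (c k, c j)))"
        if ij: "i \<in> {1..m}" "j \<in> {1..m}" for i j
      proof -
        have "P +> (A \<otimes>\<^bsub>K\<^esub> B) (c i, c j)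
            = (\<Oplus>\<^bsub>R Quot P\<^esub>k\<in>{1..m}. P +> (A (c i, c k) \<otimes> B (c k, c j)))"
          unfolding block_mult_entry[OF A B ij] using A B ij enum_class
          by (intro Q.hom_finsum_carrier) auto
        also have "\<dots> = (\<Oplus>\<^bsub>R Quot P\<^esub>k\<in>{1..m}. (P +> A (c i, c k)) \<otimes>\<^bsub>R Quot P\<^esub> (P +> B (c k, c j)))"
          using A B ij enum_class closed by (intro Q.S.finsum_cong') auto
        finally show ?thesis .
      qed
      note entry_eq = this
      have "block_map P c m (A \<otimes>\<^bsub>K\<^esub> B) = (\<lambda>(i, j)\<in>{1..m} \<times> {1..m}.
          \<Oplus>\<^bsub>R Quot P\<^esub>k\<in>{1..m}. block_map P c m A (i, k) \<otimes>\<^bsub>R Quot P\<^esub> block_map P c m B (k, j))"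
        unfolding block_map_def[of P c m "A \<otimes>\<^bsub>K\<^esub> B"]
      proof (rule restrict_ext, clarify)
        fix i j assume ij: "i \<in> {1..m}" "j \<in> {1..m}"
        show "P +> (A \<otimes>\<^bsub>K\<^esub> B) (c i, c j) = (\<Oplus>\<^bsub>R Quot P\<^esub>k\<in>{1..m}.
            block_map P c m A (i, k) \<otimes>\<^bsub>R Quot P\<^esub> block_map P c m B (k, j))"
          unfolding entry_eq[OF ij] using ij
          by (intro Q.S.finsum_cong') (auto simp: block_map_def closed[OF A] closed[OF B])
      qed
      then show "block_map P c m (A \<otimes>\<^bsub>K\<^esub> B)
          = block_map P c m A \<otimes>\<^bsub>matrix_ring m (R Quot P)\<^esub> block_map P c m B"
        by (simp add: matrix_ring_def)
      show "block_map P c m (A \<oplus>\<^bsub>K\<^esub> B)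
          = block_map P c m A \<oplus>\<^bsub>matrix_ring m (R Quot P)\<^esub> block_map P c m B"
        unfolding matrix_ring_def block_map_def using A B enum_class
        by (auto intro!: restrict_ext simp: add_entry)
    next
      have "c i = c j \<longleftrightarrow> i = j" if "i \<in> {1..m}" "j \<in> {1..m}" for i j
        using bij_betw_imp_inj_on[OF c] that by (auto dest: inj_onD)
      then show "block_map P c m \<one>\<^bsub>K\<^esub> = \<one>\<^bsub>matrix_ring m (R Quot P)\<^esub>"
        unfolding matrix_ring_def block_map_def using enum_class
        by (auto intro!: restrict_ext simp: one_entry)
    qed
  qed
qed

lemma block_map_surj: "block_map P c m ` carrier K = carrier (matrix_ring m (R Quot P))"
proof
  show "block_map P c m ` carrier K \<subseteq> carrier (matrix_ring m (R Quot P))"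
    using ring_hom_ring.homh[OF block_map_hom] by (auto dest: ring_hom_closed)
  show "carrier (matrix_ring m (R Quot P)) \<subseteq> block_map P c m ` carrier K"
  proof
    fix Y assume Y: "Y \<in> carrier (matrix_ring m (R Quot P))"
    have "\<exists>a. a \<in> carrier R \<and> Y x = P +> a" if x: "x \<in> {1..m} \<times> {1..m}" for x
    proof -
      have "Y x \<in> a_rcosets P" using PiE_mem[OF Y[unfolded carrier_block] x] .
      then show ?thesis by (auto simp: A_RCOSETS_defs a_r_coset_def[symmetric])
    qed
    then obtain y where y: "\<And>x. x \<in> {1..m} \<times> {1..m} \<Longrightarrow> y x \<in> carrier R \<and> Y x = P +> y x"
      by metis
    \<comment> \<open>A preimage: representatives on the block, zero elsewhere.\<close>
    let ?d = "inv_into {1..m} c"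
    let ?A = "\<lambda>(p, q)\<in>{1..n} \<times> {1..n}. if p \<in> c ` {1..m} \<and> q \<in> c ` {1..m} then y (?d p, ?d q) else \<zero>"
    have A: "?A \<in> carrier K"
      using y by (auto simp: carrier_K inv_into_into)
    have "block_map P c m ?A = Y"
    proof
      fix x
      show "block_map P c m ?A x = Y x"
      proof (cases "x \<in> {1..m} \<times> {1..m}")
        case True
        then obtain i j where x: "x = (i, j)" "i \<in> {1..m}" "j \<in> {1..m}" by auto
        then show ?thesis
          using y enum_class inv_into_f_f[OF bij_betw_imp_inj_on[OF c]] by (simp add: block_map_def)
      next
        case False
        then show ?thesis using PiE_arb[OF Y[unfolded carrier_block] False] by (simp add: block_map_def)
      qed
    qed
    then show "Y \<in> block_map P c m ` carrier K" using A by blast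
  qed
qed

lemma block_map_eq_zero_iff:
  assumes A: "A \<in> carrier K"
  shows "block_map P c m A = \<zero>\<^bsub>matrix_ring m (R Quot P)\<^esub>
    \<longleftrightarrow> (\<forall>i\<in>sim_class i0. \<forall>j\<in>sim_class i0. A (i, j) \<in> P)"
proof -
  interpret P: ideal P R by (rule P)
  have "P +> A (c i, c j) = P \<longleftrightarrow> A (c i, c j) \<in> P" if "i \<in> {1..m}" "j \<in> {1..m}" for i j
    using P.rcos_const_imp_mem P.a_rcos_const enum_class that A by auto
  then have "block_map P c m A = \<zero>\<^bsub>matrix_ring m (R Quot P)\<^esub>
      \<longleftrightarrow> (\<forall>i\<in>{1..m}. \<forall>j\<in>{1..m}. A (c i, c j) \<in> P)"
    by (auto simp: block_map_def matrix_ring_def FactRing_def fun_eq_iff restrict_def split: if_splits)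
  also have "\<dots> \<longleftrightarrow> (\<forall>i\<in>c ` {1..m}. \<forall>j\<in>c ` {1..m}. A (i, j) \<in> P)" by blast
  finally show ?thesis unfolding bij_betw_imp_surj_on[OF c] .
qed

end

context
  notes [simp del] = atLeastAtMost_iff One_nat_def
begin

lemma sim_class_finite: "finite (sim_class i)"
  by (simp add: sim_class_def)

lemma card_sim_class_pos: "i \<in> {1..n} \<Longrightarrow> 0 < card (sim_class i)"
  using sim_refl[of i] by (auto simp: card_gt_0_iff sim_class_finite) (auto simp: sim_class_def)

lemma enum_ex: "\<exists>c. bij_betw c {1..card (sim_class i)} (sim_class i)"
  using ex_bij_betw_nat_finite_1[OF sim_class_finite] by blast

text \<open>
  The matrices whose block on one class has entries in \<open>P\<close> are the kernel of a reduced block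
  projection. Primeness is inherited from \<open>P\<close>: given entries of \<open>A\<close> and \<open>B\<close> in the block, a
  one-entry matrix placed between them produces every sandwich of these entries.
\<close>

lemma block_ideal_prime:
  assumes P: "nc_prime_ideal R P" and i0: "i0 \<in> {1..n}"
  shows "nc_prime_ideal K {A \<in> carrier K. \<forall>i\<in>sim_class i0. \<forall>j\<in>sim_class i0. A (i, j) \<in> P}"
    (is "nc_prime_ideal K ?J")
proof -
  interpret K: ring K by (rule ring_K)
  have id: "ideal P R" and ne: "P \<noteq> carrier R"
    and prime: "\<And>a b. \<lbrakk>a \<in> carrier R; b \<in> carrier R; \<And>x. x \<in> carrier R \<Longrightarrow> a \<otimes> x \<otimes> b \<in> P\<rbrakk> \<Longrightarrow> a \<in> P \<or> b \<in> P"
    using P unfolding nc_prime_ideal_iff_elementwise by auto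
  obtain c where c: "bij_betw c {1..card (sim_class i0)} (sim_class i0)" using enum_ex by blast
  have cls: "i \<in> {1..n}" "sim i0 i" if "i \<in> sim_class i0" for i using that by (auto simp: sim_class_def)
  have simc: "sim i j" if "i \<in> sim_class i0" "j \<in> sim_class i0" for i j
    using that cls sim_sym sim_trans i0 by meson
  have i0c: "i0 \<in> sim_class i0" using i0 sim_refl unfolding sim_class_def by blast
  show ?thesis unfolding K.nc_prime_ideal_iff_elementwise
  proof (intro conjI ballI impI)
    have "?J = a_kernel K (matrix_ring (card (sim_class i0)) (R Quot P)) (block_map P c (card (sim_class i0)))"
      unfolding a_kernel_def' using block_map_eq_zero_iff[OF id i0 c] by blast
    then show "ideal ?J K"
      using ring_hom_ring.kernel_is_ideal[OF block_map_hom[OF id i0 c]] by simp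
    have "\<one> \<notin> P" using ne ideal.one_imp_carrier[OF id] by blast
    then have "\<one>\<^bsub>K\<^esub> \<notin> ?J" using i0 i0c one_entry by force
    then show "?J \<noteq> carrier K" using K_one_closed by blast
    fix A B assume A: "A \<in> carrier K" and B: "B \<in> carrier K"
      and AB: "\<forall>X\<in>carrier K. A \<otimes>\<^bsub>K\<^esub> X \<otimes>\<^bsub>K\<^esub> B \<in> ?J"
    show "A \<in> ?J \<or> B \<in> ?J"
    proof (rule ccontr)
      assume "\<not> ?thesis"
      then obtain i j k l where ij: "i \<in> sim_class i0" "j \<in> sim_class i0" "A (i, j) \<notin> P"
        and kl: "k \<in> sim_class i0" "l \<in> sim_class i0" "B (k, l) \<notin> P"
        using A B by blast
      note N = cls(1)[OF ij(1)] cls(1)[OF ij(2)] cls(1)[OF kl(1)] cls(1)[OF kl(2)]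
      have "A (i, j) \<otimes> x \<otimes> B (k, l) \<in> P" if x: "x \<in> carrier R" for x
      proof -
        have "(A \<otimes>\<^bsub>K\<^esub> single j k x \<otimes>\<^bsub>K\<^esub> B) (i, l) = A (i, j) \<otimes> x \<otimes> B (k, l)"
        proof -
          have "(A \<otimes>\<^bsub>K\<^esub> single j k x \<otimes>\<^bsub>K\<^esub> B) (i, l)
              = s i k l \<otimes> (A \<otimes>\<^bsub>K\<^esub> single j k x) (i, k) \<otimes> B (k, l)"
            unfolding mult_entry[OF N(1,4), of "A \<otimes>\<^bsub>K\<^esub> single j k x"]
            by (rule finsum_eq_single)
              (use A B N x in \<open>auto simp: mult_single multiplier_closed intro!: mult_term_closed K_mult_closed single_closed\<close>)
          also have "\<dots> = A (i, j) \<otimes> x \<otimes> B (k, l)"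
            using A B N x simc ij kl by (simp add: mult_single multiplier_eq_one_left)
          finally show ?thesis .
        qed
        moreover have "A \<otimes>\<^bsub>K\<^esub> single j k x \<otimes>\<^bsub>K\<^esub> B \<in> ?J" using AB single_closed[OF x] by blast
        then have "(A \<otimes>\<^bsub>K\<^esub> single j k x \<otimes>\<^bsub>K\<^esub> B) (i, l) \<in> P" using ij(1) kl(2) by blast
        ultimately show ?thesis by simp
      qed
      then show False using prime[of "A (i, j)" "B (k, l)"] ij kl A B N by simp
    qed
  qed
qed

text \<open>
  The elements that a prime ideal \<open>Q\<close> of the matrix ring contains at the diagonal position \<open>i\<close>
  form a prime ideal of \<open>R\<close> or all of \<open>R\<close>, so the prime radical of \<open>R\<close> is contained in them. A
  factor on the right moves the entry from position \<open>(i, i)\<close> to \<open>(i, j)\<close>.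
\<close>

lemma single_mem_prime_ideal:
  assumes Q: "nc_prime_ideal K Q" and ij: "i \<in> {1..n}" "j \<in> {1..n}" "sim i j"
    and a: "a \<in> prime_radical R"
  shows "single i j a \<in> Q"
proof -
  interpret K: ring K by (rule ring_K)
  have id: "ideal Q K"
    and prime: "\<And>a b. \<lbrakk>a \<in> carrier K; b \<in> carrier K; \<And>x. x \<in> carrier K \<Longrightarrow> a \<otimes>\<^bsub>K\<^esub> x \<otimes>\<^bsub>K\<^esub> b \<in> Q\<rbrakk> \<Longrightarrow> a \<in> Q \<or> b \<in> Q"
    using Q unfolding K.nc_prime_ideal_iff_elementwise by auto
  interpret Q: ideal Q K by (rule id)
  note sandwich = single_mult_single[OF ij(1) ij(1) ij(1) ij(1)]
  define P where "P = {a \<in> carrier R. single i i a \<in> Q}"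
  have aR: "a \<in> carrier R" using a by (simp add: prime_radical_def)
  have "a \<in> P"
  proof (cases "P = carrier R")
    case False
    have "nc_prime_ideal R P" unfolding nc_prime_ideal_iff_elementwise
    proof (intro conjI ballI impI False)
      have mult: "single i i x \<otimes>\<^bsub>K\<^esub> single i i y = single i i (x \<otimes> y)" if "x \<in> carrier R" "y \<in> carrier R" for x y
        using single_mult_single_adjacent[OF ij(1) ij(1) ij(1) that] that ij(1)
        by (simp add: multiplier_left)
      show "ideal P R"
      proof (rule ideal_of_closure)
        show "\<zero> \<in> P" by (simp add: P_def single_zero)
        fix x y assume x: "x \<in> P" and y: "y \<in> P"
        have "single i i (x \<oplus> y) = single i i x \<oplus>\<^bsub>K\<^esub> single i i y"
          using x y by (intro matrix_eqI K_add_closed single_closed)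
            (auto simp: P_def single_entry add_entry)
        then show "x \<oplus> y \<in> P" using x y by (simp add: P_def)
      next
        fix x r assume x: "x \<in> P" and r: "r \<in> carrier R"
        show "r \<otimes> x \<in> P" "x \<otimes> r \<in> P"
          using x r mult[of r x] mult[of x r] Q.I_l_closed[of "single i i x" "single i i r"]
            Q.I_r_closed[of "single i i x" "single i i r"] by (auto simp: P_def single_closed)
      qed (auto simp: P_def)
      fix x y assume x: "x \<in> carrier R" and y: "y \<in> carrier R" and xy: "\<forall>z\<in>carrier R. x \<otimes> z \<otimes> y \<in> P"
      have "single i i x \<otimes>\<^bsub>K\<^esub> Z \<otimes>\<^bsub>K\<^esub> single i i y \<in> Q" if Z: "Z \<in> carrier K" for Z
        using sandwich[OF x y Z] bspec[OF xy, of "Z (i, i)"] Z ij(1) x y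
        by (simp add: P_def multiplier_left)
      then show "x \<in> P \<or> y \<in> P"
        using prime[of "single i i x" "single i i y"] x y by (auto simp: P_def single_closed)
    qed
    then show ?thesis using a unfolding prime_radical_def by blast
  qed (use aR in simp)
  then have "single i i a \<otimes>\<^bsub>K\<^esub> single i j \<one> \<in> Q"
    by (intro Q.I_r_closed single_closed) (auto simp: P_def)
  moreover have "single i i a \<otimes>\<^bsub>K\<^esub> single i j \<one> = single i j a"
    using single_mult_single_adjacent[OF ij(1) ij(1) ij(2) aR one_closed] ij(1,2) aR
    by (simp add: multiplier_left)
  ultimately show ?thesis by simp
qed

text \<open>
  All sandwiches of this matrix with itself are zero, since they carry the multiplier
  \<open>s i j i = \<zero>\<close>.
\<close>

lemma off_block_single_mem_prime_ideal:
  assumes Q: "nc_prime_ideal K Q" and ij: "i \<in> {1..n}" "j \<in> {1..n}" "\<not> sim i j"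
    and a: "a \<in> carrier R"
  shows "single i j a \<in> Q"
proof -
  interpret K: ring K by (rule ring_K)
  have id: "ideal Q K"
    and prime: "\<And>a b. \<lbrakk>a \<in> carrier K; b \<in> carrier K; \<And>x. x \<in> carrier K \<Longrightarrow> a \<otimes>\<^bsub>K\<^esub> x \<otimes>\<^bsub>K\<^esub> b \<in> Q\<rbrakk> \<Longrightarrow> a \<in> Q \<or> b \<in> Q"
    using Q unfolding K.nc_prime_ideal_iff_elementwise by auto
  have "s i j i = \<zero>" using multiplier_01[of i j i] ij by (auto simp: sim_def)
  then have "single i j a \<otimes>\<^bsub>K\<^esub> X \<otimes>\<^bsub>K\<^esub> single i j a = single i j \<zero>" if "X \<in> carrier K" for X
    using single_mult_single[OF ij(1,2) ij(1,2) a a that] that ij a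
    by (simp add: multiplier_closed)
  moreover have "\<zero>\<^bsub>K\<^esub> \<in> Q" using additive_subgroup.zero_closed[OF ideal.axioms(1)[OF id]] .
  ultimately show ?thesis using prime[of "single i j a" "single i j a"] single_closed[OF a]
    by (auto simp: single_zero)
qed

theorem prime_radical_K:
  "prime_radical K = {A \<in> carrier K. \<forall>i\<in>{1..n}. \<forall>j\<in>{1..n}. sim i j \<longrightarrow> A (i, j) \<in> prime_radical R}"
proof (intro equalityI subsetI)
  fix A assume A: "A \<in> prime_radical K"
  then have AK: "A \<in> carrier K" by (simp add: prime_radical_def)
  have "A (i, j) \<in> P" if "i \<in> {1..n}" "j \<in> {1..n}" "sim i j" "nc_prime_ideal R P" for i j P
    using A block_ideal_prime[OF that(4,1)] sim_refl[OF that(1)] that(1-3)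
    unfolding prime_radical_def sim_class_def by blast
  then show "A \<in> {A \<in> carrier K. \<forall>i\<in>{1..n}. \<forall>j\<in>{1..n}. sim i j \<longrightarrow> A (i, j) \<in> prime_radical R}"
    using AK unfolding prime_radical_def by auto
next
  fix A assume A: "A \<in> {A \<in> carrier K. \<forall>i\<in>{1..n}. \<forall>j\<in>{1..n}. sim i j \<longrightarrow> A (i, j) \<in> prime_radical R}"
  have "A \<in> Q" if Q: "nc_prime_ideal K Q" for Q
  proof (rule mem_ideal_if_entries)
    show "ideal Q K" using Q unfolding nc_prime_ideal_def by simp
    show "A \<in> carrier K" using A by simp
    fix i j assume "i \<in> {1..n}" "j \<in> {1..n}"
    then show "single i j (A (i, j)) \<in> Q"
      using A single_mem_prime_ideal[OF Q] off_block_single_mem_prime_ideal[OF Q] by (cases "sim i j") auto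
  qed
  then show "A \<in> prime_radical K" using A unfolding prime_radical_def by blast
qed

end

end

section \<open>The decomposition modulo the prime radical\<close>

context formal_matrices_01
begin

text \<open>
  The target of the block projection is a matrix ring indexed by \<open>{1..card C}\<close>, so some
  enumeration of the class is chosen.
\<close>

definition class_hom :: "'a set \<Rightarrow> nat set \<Rightarrow> (nat \<times> nat \<Rightarrow> 'a) \<Rightarrow> nat \<times> nat \<Rightarrow> 'a set" where
  "class_hom P C = block_map P (SOME c. bij_betw c {1..card C} C) (card C)"

lemma some_enum: "bij_betw (SOME c. bij_betw c {1..card (sim_class i)} (sim_class i))
    {1..card (sim_class i)} (sim_class i)"
  by (rule someI_ex[OF enum_ex])

lemma class_hom_eq_zero_iff:
  assumes "ideal P R" "i0 \<in> {1..n}" "A \<in> carrier K"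
  shows "class_hom P (sim_class i0) A = \<zero>\<^bsub>matrix_ring (card (sim_class i0)) (R Quot P)\<^esub>
    \<longleftrightarrow> (\<forall>i\<in>sim_class i0. \<forall>j\<in>sim_class i0. A (i, j) \<in> P)"
  unfolding class_hom_def by (rule block_map_eq_zero_iff[OF assms(1,2) some_enum assms(3)])

lemma sim_class_fibre:
  assumes "C \<in> sim_class ` {1..n}"
  shows "{i \<in> {1..n}. sim_class i = C} = C"
proof -
  obtain i where i: "i \<in> {1..n}" "C = sim_class i" using assms by blast
  have "k \<in> sim_class i \<longleftrightarrow> k \<in> {1..n} \<and> sim_class k = sim_class i" for k
    using sim_class_eq_iff[OF i(1), of k] unfolding sim_class_def[of i] by fastforce
  then show ?thesis unfolding i(2) by blast
qed

text \<open>
  By the description of the prime radical it is the joint kernel of the block projections modulo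
  the prime radical of \<open>R\<close>. The targets are matrix rings over an indecomposable ring.
\<close>

theorem splitting:
  assumes indec: "indecomposable_ring (R Quot prime_radical R)"
    and nontriv: "\<one>\<^bsub>R Quot prime_radical R\<^esub> \<noteq> \<zero>\<^bsub>R Quot prime_radical R\<^esub>"
  shows "indecomposable_splitting K (sim_class ` {1..n})
    (\<lambda>C. matrix_ring (card C) (R Quot prime_radical R)) (class_hom (prime_radical R)) (prime_radical K)"
proof (intro indecomposable_splitting.intro indecomposable_splitting_axioms.intro ring_K)
  let ?P = "prime_radical R"
  let ?M = "\<lambda>C. matrix_ring (card C) (R Quot ?P)"
  note id = prime_radical_ideal
  have Q: "ring (R Quot ?P)" by (rule ideal.quotient_is_ring[OF id])
  show "prime_radical K = {x \<in> carrier K. \<forall>C\<in>sim_class ` {1..n}. class_hom ?P C x = \<zero>\<^bsub>?M C\<^esub>}"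
  proof -
    have "(\<forall>C\<in>sim_class ` {1..n}. class_hom ?P C A = \<zero>\<^bsub>?M C\<^esub>)
        \<longleftrightarrow> (\<forall>i\<in>{1..n}. \<forall>j\<in>{1..n}. sim i j \<longrightarrow> A (i, j) \<in> ?P)" if A: "A \<in> carrier K" for A
    proof -
      have "(\<forall>C\<in>sim_class ` {1..n}. class_hom ?P C A = \<zero>\<^bsub>?M C\<^esub>)
          \<longleftrightarrow> (\<forall>i0\<in>{1..n}. \<forall>i\<in>sim_class i0. \<forall>j\<in>sim_class i0. A (i, j) \<in> ?P)"
        using class_hom_eq_zero_iff[OF id _ A] by simp
      also have "\<dots> \<longleftrightarrow> (\<forall>i\<in>{1..n}. \<forall>j\<in>{1..n}. sim i j \<longrightarrow> A (i, j) \<in> ?P)"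
      proof (intro iffI ballI impI)
        fix i j assume *: "\<forall>i0\<in>{1..n}. \<forall>i\<in>sim_class i0. \<forall>j\<in>sim_class i0. A (i, j) \<in> ?P"
          and "i \<in> {1..n}" "j \<in> {1..n}" "sim i j"
        then show "A (i, j) \<in> ?P" using sim_refl[of i] unfolding sim_class_def by blast
      next
        fix i0 i j assume *: "\<forall>i\<in>{1..n}. \<forall>j\<in>{1..n}. sim i j \<longrightarrow> A (i, j) \<in> ?P"
          and i0: "i0 \<in> {1..n}" and ij: "i \<in> sim_class i0" "j \<in> sim_class i0"
        have "i \<in> {1..n}" "j \<in> {1..n}" "sim i0 i" "sim i0 j" using ij unfolding sim_class_def by auto
        then show "A (i, j) \<in> ?P" using * i0 sim_sym sim_trans by meson
      qed
      finally show ?thesis .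
    qed
    then show ?thesis unfolding prime_radical_K by blast
  qed
  fix C assume "C \<in> sim_class ` {1..n}"
  then obtain i0 where i0: "i0 \<in> {1..n}" and C: "C = sim_class i0" by blast
  have i0C: "i0 \<in> C" using i0 sim_refl unfolding C sim_class_def by blast
  show "ring_hom_ring K (?M C) (class_hom ?P C)"
    unfolding C class_hom_def by (rule block_map_hom[OF id i0 some_enum])
  then interpret h: ring_hom_ring K "?M C" "class_hom ?P C" .
  show "class_hom ?P C ` carrier K = carrier (?M C)"
    unfolding C class_hom_def by (rule block_map_surj[OF id i0 some_enum])
  show "indecomposable_ring (?M C)"
    by (rule indecomposable_matrix_ring[OF Q indec]) (simp add: C card_sim_class_pos[OF i0])
  have proper: "\<one> \<notin> ?P"
  proof
    assume "\<one> \<in> ?P"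
    then have "?P +> \<one> = ?P" using abelian_subgroup.a_rcos_const[OF abelian_subgroupI3]
      id ideal.axioms(1) by (metis is_abelian_group)
    then show False using nontriv by (simp add: FactRing_def)
  qed
  have "class_hom ?P C \<one>\<^bsub>K\<^esub> \<noteq> \<zero>\<^bsub>?M C\<^esub>"
    using class_hom_eq_zero_iff[OF id i0 K_one_closed] proper i0C one_entry[OF i0 i0] unfolding C by force
  then show "\<one>\<^bsub>?M C\<^esub> \<noteq> \<zero>\<^bsub>?M C\<^esub>" by simp
  \<comment> \<open>The partial identity matrices of the class and of its complement add up to the identity. The
    second one projects to zero, so the first one projects to the identity of the block.\<close>
  let ?E = "\<lambda>(i, j)\<in>{1..n} \<times> {1..n}. if i = j \<and> i \<in> C then \<one> else \<zero>"
  let ?F = "\<lambda>(i, j)\<in>{1..n} \<times> {1..n}. if i = j \<and> i \<notin> C then \<one> else \<zero>"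
  have E: "?E \<in> carrier K" and F: "?F \<in> carrier K" by (auto simp: carrier_K)
  have CN: "C \<subseteq> {1..n}" unfolding C sim_class_def by blast
  have EF: "?E \<oplus>\<^bsub>K\<^esub> ?F = \<one>\<^bsub>K\<^esub>"
    using E F by (intro matrix_eqI K_add_closed K_one_closed) (auto simp: add_entry one_entry)
  show "\<exists>e\<in>carrier K. class_hom ?P C e = \<one>\<^bsub>?M C\<^esub>
      \<and> (\<forall>D\<in>sim_class ` {1..n} - {C}. class_hom ?P D e = \<zero>\<^bsub>?M D\<^esub>)"
  proof (intro bexI[OF _ E] conjI ballI)
    have zP: "\<zero> \<in> ?P" using additive_subgroup.zero_closed[OF ideal.axioms(1)[OF id]] .
    have "class_hom ?P C ?F = \<zero>\<^bsub>?M C\<^esub>"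
      using class_hom_eq_zero_iff[OF id i0 F] CN zP unfolding C by auto
    then have "class_hom ?P C \<one>\<^bsub>K\<^esub> = class_hom ?P C ?E"
      unfolding EF[symmetric] using E F by simp
    then show "class_hom ?P C ?E = \<one>\<^bsub>?M C\<^esub>" by simp
    fix D assume D: "D \<in> sim_class ` {1..n} - {C}"
    then obtain j0 where j0: "j0 \<in> {1..n}" "D = sim_class j0" "sim_class j0 \<noteq> C" by blast
    have "k \<notin> C" if "k \<in> sim_class j0" for k
    proof
      assume "k \<in> C"
      then have k: "k \<in> {1..n}" "sim i0 k" "sim j0 k" using that unfolding C sim_class_def by auto
      then have "sim_class i0 = sim_class k" "sim_class j0 = sim_class k"
        using sim_class_eq_iff[OF i0 k(1)] sim_class_eq_iff[OF j0(1) k(1)] by simp_all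
      then show False using j0(3) C by simp
    qed
    then show "class_hom ?P D ?E = \<zero>\<^bsub>?M D\<^esub>"
      using class_hom_eq_zero_iff[OF id j0(1) E] zP unfolding j0(2)
      by (auto simp: sim_class_def)
  qed
qed

end

text \<open>
  Over the zero ring the matrix rings of orders one and two are both zero, hence isomorphic.
\<close>

lemma nm_condition_nontrivial:
  assumes R: "ring R" and nm: "nm_condition R"
  shows "\<one>\<^bsub>R\<^esub> \<noteq> \<zero>\<^bsub>R\<^esub>"
proof
  assume eq: "\<one>\<^bsub>R\<^esub> = \<zero>\<^bsub>R\<^esub>"
  interpret ring R by fact
  have car: "carrier R = {\<zero>\<^bsub>R\<^esub>}" using eq carrier_one_zero by simp
  have trivial: "carrier (matrix_ring m R) = {\<zero>\<^bsub>matrix_ring m R\<^esub>}" for m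
  proof -
    interpret M: ring "matrix_ring m R" by (rule ring_matrix_ring[OF R])
    have "A = \<zero>\<^bsub>matrix_ring m R\<^esub>" if "A \<in> carrier (matrix_ring m R)" for A
      using that car unfolding matrix_ring_def by (auto simp: PiE_iff extensional_def fun_eq_iff)
    then show ?thesis by blast
  qed
  have "(\<lambda>_. \<zero>\<^bsub>matrix_ring 2 R\<^esub>) \<in> ring_iso (matrix_ring 1 R) (matrix_ring 2 R)"
  proof (rule ring_iso_memI)
    interpret M: ring "matrix_ring 2 R" by (rule ring_matrix_ring[OF R])
    show "bij_betw (\<lambda>_. \<zero>\<^bsub>matrix_ring 2 R\<^esub>) (carrier (matrix_ring 1 R)) (carrier (matrix_ring 2 R))"
      unfolding trivial bij_betw_def by simp
    show "\<zero>\<^bsub>matrix_ring 2 R\<^esub> = \<one>\<^bsub>matrix_ring 2 R\<^esub>" using M.one_closed unfolding trivial by simp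
  qed (simp_all add: ring.ring_simprules[OF ring_matrix_ring[OF R]] trivial)
  then have "matrix_ring 1 R \<simeq> matrix_ring 2 R" unfolding is_ring_iso_def by blast
  then show False using nm[unfolded nm_condition_def, rule_format, of 1 2] by simp
qed

text \<open>
  Renaming rows and columns by \<open>f\<close> renames the indices of the multipliers in the same way.
\<close>

lemma (in formal_matrices) ring_iso_reindex:
  assumes t: "\<And>i j k. \<lbrakk>i \<in> {1..n}; j \<in> {1..n}; k \<in> {1..n}\<rbrakk> \<Longrightarrow> t i j k = s (f i) (f j) (f k)"
    and f: "bij_betw f {1..n} {1..n}"
  shows "K \<simeq> formal_matrix_ring n R t"
proof -
  define \<Phi> where "\<Phi> = (\<lambda>A. \<lambda>(i, j)\<in>{1..n} \<times> {1..n}. A (f i, f j) :: 'a)"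
  have \<Phi>_apply: "\<Phi> A = (\<lambda>(i, j)\<in>{1..n} \<times> {1..n}. A (f i, f j))" for A by (simp add: \<Phi>_def)
  define g where "g = inv_into {1..n} f"
  define \<Psi> where "\<Psi> = (\<lambda>A. \<lambda>(i, j)\<in>{1..n} \<times> {1..n}. A (g i, g j) :: 'a)"
  have g: "bij_betw g {1..n} {1..n}" unfolding g_def by (rule bij_betw_inv_into[OF f])
  have fc: "f i \<in> {1..n}" and gc: "g i \<in> {1..n}" and gf: "g (f i) = i" and fg: "f (g i) = i"
    if "i \<in> {1..n}" for i
    using that bij_betwE[OF f] bij_betwE[OF g] bij_betw_inv_into_left[OF f] bij_betw_inv_into_right[OF f]
    unfolding g_def by blast+
  have car_t: "carrier (formal_matrix_ring n R t) = {1..n} \<times> {1..n} \<rightarrow>\<^sub>E carrier R"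
    by (simp add: formal_matrix_ring_def)
  have "\<Phi> \<in> ring_iso K (formal_matrix_ring n R t)"
  proof (rule ring_iso_memI)
    show "bij_betw \<Phi> (carrier K) (carrier (formal_matrix_ring n R t))"
    proof (rule bij_betwI[where g = \<Psi>])
      show "\<Phi> \<in> carrier K \<rightarrow> carrier (formal_matrix_ring n R t)"
        using fc by (auto simp: \<Phi>_def formal_matrix_ring_def split: if_splits simp del: atLeastAtMost_iff)
      show "\<Psi> \<in> carrier (formal_matrix_ring n R t) \<rightarrow> carrier K"
        using gc by (auto simp: \<Psi>_def formal_matrix_ring_def split: if_splits simp del: atLeastAtMost_iff)
      show "\<Psi> (\<Phi> A) = A" if "A \<in> carrier K" for A
      proof
        fix x
        show "\<Psi> (\<Phi> A) x = A x"
        proof (cases "x \<in> {1..n} \<times> {1..n}")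
          case True
          then obtain i j where "x = (i, j)" "i \<in> {1..n}" "j \<in> {1..n}" by blast
          then show ?thesis by (simp add: \<Phi>_def \<Psi>_def fc gc fg gf del: atLeastAtMost_iff One_nat_def)
        next
          case False
          then show ?thesis using PiE_arb[OF that[unfolded carrier_K] False] by (simp add: \<Phi>_def \<Psi>_def)
        qed
      qed
      show "\<Phi> (\<Psi> A) = A" if "A \<in> carrier (formal_matrix_ring n R t)" for A
      proof
        fix x
        show "\<Phi> (\<Psi> A) x = A x"
        proof (cases "x \<in> {1..n} \<times> {1..n}")
          case True
          then obtain i j where "x = (i, j)" "i \<in> {1..n}" "j \<in> {1..n}" by blast
          then show ?thesis by (simp add: \<Phi>_def \<Psi>_def fc gc fg gf del: atLeastAtMost_iff One_nat_def)
        next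
          case False
          then show ?thesis using PiE_arb[OF that[unfolded car_t] False] by (simp add: \<Phi>_def \<Psi>_def)
        qed
      qed
    qed
    fix A B assume A: "A \<in> carrier K" and B: "B \<in> carrier K"
    show "\<Phi> A \<in> carrier (formal_matrix_ring n R t)"
      using A fc by (auto simp: \<Phi>_def formal_matrix_ring_def split: if_splits simp del: atLeastAtMost_iff)
    show "\<Phi> (A \<oplus>\<^bsub>K\<^esub> B) = \<Phi> A \<oplus>\<^bsub>formal_matrix_ring n R t\<^esub> \<Phi> B"
      using fc by (auto simp: \<Phi>_def formal_matrix_ring_def intro!: restrict_ext simp del: atLeastAtMost_iff)
    have entry: "(A \<otimes>\<^bsub>K\<^esub> B) (f i, f j) = (\<Oplus>k\<in>{1..n}. t i k j \<otimes> \<Phi> A (i, k) \<otimes> \<Phi> B (k, j))"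
      if ij: "i \<in> {1..n}" "j \<in> {1..n}" for i j
    proof -
      have "(A \<otimes>\<^bsub>K\<^esub> B) (f i, f j)
          = (\<Oplus>k\<in>f ` {1..n}. s (f i) k (f j) \<otimes> A (f i, k) \<otimes> B (k, f j))"
        using mult_entry[OF fc fc, OF ij] unfolding bij_betw_imp_surj_on[OF f] .
      also have "\<dots> = (\<Oplus>k\<in>{1..n}. s (f i) (f k) (f j) \<otimes> A (f i, f k) \<otimes> B (f k, f j))"
        by (rule finsum_reindex[OF _ bij_betw_imp_inj_on[OF f]])
          (use fc ij A B in \<open>blast intro: mult_term_closed\<close>)
      also have "\<dots> = (\<Oplus>k\<in>{1..n}. t i k j \<otimes> \<Phi> A (i, k) \<otimes> \<Phi> B (k, j))"
      proof (rule finsum_cong')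
        fix k assume k: "k \<in> {1..n}"
        show "s (f i) (f k) (f j) \<otimes> A (f i, f k) \<otimes> B (f k, f j) = t i k j \<otimes> \<Phi> A (i, k) \<otimes> \<Phi> B (k, j)"
          using ij k by (simp add: t \<Phi>_def)
      next
        show "(\<lambda>k. t i k j \<otimes> \<Phi> A (i, k) \<otimes> \<Phi> B (k, j)) \<in> {1..n} \<rightarrow> carrier R"
        proof
          fix k assume k: "k \<in> {1..n}"
          show "t i k j \<otimes> \<Phi> A (i, k) \<otimes> \<Phi> B (k, j) \<in> carrier R"
            using mult_term_closed[OF A B fc[OF ij(1)] fc[OF ij(2)] fc[OF k]] ij k by (simp add: t \<Phi>_def)
        qed
      qed simp
      finally show ?thesis .
    qed
    show "\<Phi> (A \<otimes>\<^bsub>K\<^esub> B) = \<Phi> A \<otimes>\<^bsub>formal_matrix_ring n R t\<^esub> \<Phi> B"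
    proof -
      have "\<Phi> (A \<otimes>\<^bsub>K\<^esub> B) = (\<lambda>(i, j)\<in>{1..n} \<times> {1..n}.
          \<Oplus>k\<in>{1..n}. t i k j \<otimes> \<Phi> A (i, k) \<otimes> \<Phi> B (k, j))"
        unfolding \<Phi>_apply[of "A \<otimes>\<^bsub>K\<^esub> B"] by (rule restrict_ext, clarify) (rule entry)
      then show ?thesis by (simp add: formal_matrix_ring_def)
    qed
  next
    have "f i = f j \<longleftrightarrow> i = j" if "i \<in> {1..n}" "j \<in> {1..n}" for i j using gf that by metis
    then show "\<Phi> \<one>\<^bsub>K\<^esub> = \<one>\<^bsub>formal_matrix_ring n R t\<^esub>"
      using fc by (auto simp: \<Phi>_def formal_matrix_ring_def intro!: restrict_ext simp del: atLeastAtMost_iff)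
  qed
  then show ?thesis unfolding is_ring_iso_def by blast
qed

section \<open>Isomorphism and canonical forms\<close>

theorem theorem4p1:
  fixes R :: "('a, 'b) ring_scheme"
    and n :: nat
    and s t :: "nat \<Rightarrow> nat \<Rightarrow> nat \<Rightarrow> 'a"
  assumes "ring R"
    and "\<one>\<^bsub>R\<^esub> \<noteq> \<zero>\<^bsub>R\<^esub>"
    and "indecomposable_ring (R Quot prime_radical R)"
    and "nm_condition (R Quot prime_radical R)"
    and "n \<ge> 2"
    and "multipliers_01 n R s"
    and "multipliers_01 n R t"
  shows "(formal_matrix_ring n R s \<simeq> formal_matrix_ring n R t \<longrightarrow>
            same_canonical_forms n R (principal_multiplier_matrix n s) (principal_multiplier_matrix n t))
       \<and> (form_K0 n R s \<and> form_K0 n R t \<and>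
            same_canonical_forms n R (principal_multiplier_matrix n s) (principal_multiplier_matrix n t) \<longrightarrow>
            formal_matrix_ring n R s \<simeq> formal_matrix_ring n R t)"
proof (intro conjI impI)
  interpret R: ring R by fact
  interpret S: formal_matrices_01 R n s
    using assms unfolding multipliers_01_def
    by (simp add: formal_matrices_01_def formal_matrices_01_axioms_def formal_matrices_def formal_matrices_axioms_def)
  interpret T: formal_matrices_01 R n t
    using assms unfolding multipliers_01_def
    by (simp add: formal_matrices_01_def formal_matrices_01_axioms_def formal_matrices_def formal_matrices_axioms_def)
  let ?Q = "R Quot prime_radical R"
  let ?M = "\<lambda>C. matrix_ring (card C) ?Q"
  {
    assume "S.K \<simeq> T.K"
    then obtain \<phi> where \<phi>: "\<phi> \<in> ring_iso S.K T.K" unfolding is_ring_iso_def by blast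
    have "ring ?Q" using ideal.quotient_is_ring[OF R.prime_radical_ideal] .
    note nontriv = nm_condition_nontrivial[OF this assms(4)]
    interpret A: indecomposable_splitting S.K "S.sim_class ` {1..n}" ?M
      "S.class_hom (prime_radical R)" "prime_radical S.K"
      by (rule S.splitting[OF assms(3) nontriv])
    interpret B0: indecomposable_splitting T.K "T.sim_class ` {1..n}" ?M
      "T.class_hom (prime_radical R)" "prime_radical T.K"
      by (rule T.splitting[OF assms(3) nontriv])
    interpret B: indecomposable_splitting S.K "T.sim_class ` {1..n}" ?M
      "\<lambda>C. T.class_hom (prime_radical R) C \<circ> \<phi>" "prime_radical S.K"
      unfolding prime_radical_ring_iso_vimage[OF S.ring_K T.ring_K \<phi>]
      by (rule B0.pull_back_iso[OF S.ring_K \<phi>])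
    interpret two_splittings S.K "S.sim_class ` {1..n}" ?M "S.class_hom (prime_radical R)" "prime_radical S.K"
      "T.sim_class ` {1..n}" ?M "\<lambda>C. T.class_hom (prime_radical R) C \<circ> \<phi>" ..
    obtain g where g: "bij_betw g (S.sim_class ` {1..n}) (T.sim_class ` {1..n})"
        "\<And>C. C \<in> S.sim_class ` {1..n} \<Longrightarrow> ?M C \<simeq> ?M (g C)"
      using components_match by blast
    have card: "card (g C) = card C" if C: "C \<in> S.sim_class ` {1..n}" for C
    proof -
      have "g C \<in> T.sim_class ` {1..n}" using g(1) C by (auto dest: bij_betwE)
      then have "0 < card C" "0 < card (g C)"
        using C S.card_sim_class_pos T.card_sim_class_pos by (auto simp del: atLeastAtMost_iff One_nat_def)
      then show ?thesis using assms(4) g(2)[OF C] unfolding nm_condition_def by metis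
    qed
    \<comment> \<open>Listing the classes of \<open>t\<close> in the order of their partners gives equal lists of block sizes.\<close>
    obtain xs where xs: "distinct xs" "set xs = S.sim_class ` {1..n}"
      using finite_distinct_list[of "S.sim_class ` {1..n}"] by auto
    have gxs: "distinct (map g xs)" "set (map g xs) = T.sim_class ` {1..n}"
      using xs g(1) by (auto simp: distinct_map bij_betw_def)
    have "canonical_form_of n R (principal_multiplier_matrix n s)
        (map (\<lambda>C. card {i \<in> {1..n}. S.sim_class i = C}) xs)"
      by (rule canonical_form_of_colouring[OF S.principal_multiplier_matrix_entry xs])
    moreover have "canonical_form_of n R (principal_multiplier_matrix n t)
        (map (\<lambda>C. card {i \<in> {1..n}. T.sim_class i = C}) (map g xs))"
      by (rule canonical_form_of_colouring[OF T.principal_multiplier_matrix_entry gxs])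
    moreover have "map (\<lambda>C. card {i \<in> {1..n}. S.sim_class i = C}) xs
        = map (\<lambda>C. card {i \<in> {1..n}. T.sim_class i = C}) (map g xs)"
      unfolding map_map map_eq_conv
    proof
      fix C assume "C \<in> set xs"
      then have C: "C \<in> S.sim_class ` {1..n}" "g C \<in> T.sim_class ` {1..n}" using xs(2) bij_betwE[OF g(1)] by blast+
      show "card {i \<in> {1..n}. S.sim_class i = C}
          = ((\<lambda>C. card {i \<in> {1..n}. T.sim_class i = C}) \<circ> g) C"
        unfolding o_apply S.sim_class_fibre[OF C(1)] T.sim_class_fibre[OF C(2)] card[OF C(1)] ..
    qed
    ultimately show "same_canonical_forms n R (principal_multiplier_matrix n s) (principal_multiplier_matrix n t)"
      unfolding same_canonical_forms_def by metis
  }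
  {
    assume K0: "form_K0 n R s \<and> form_K0 n R t \<and>
      same_canonical_forms n R (principal_multiplier_matrix n s) (principal_multiplier_matrix n t)"
    then obtain f where f: "bij_betw f {1..n} {1..n}"
        "\<And>i j. \<lbrakk>i \<in> {1..n}; j \<in> {1..n}\<rbrakk> \<Longrightarrow>
          principal_multiplier_matrix n s (f i, f j) = principal_multiplier_matrix n t (i, j)"
      using same_canonical_formsE by metis
    have fc: "f i \<in> {1..n}" if "i \<in> {1..n}" for i using f(1) that by (auto dest: bij_betwE)
    have sim: "S.sim (f i) (f j) \<longleftrightarrow> T.sim i j" if "i \<in> {1..n}" "j \<in> {1..n}" for i j
      using f(2)[OF that] fc that assms(2)
      unfolding S.sim_def T.sim_def by (simp add: principal_multiplier_matrix_def)
    have "t i j k = s (f i) (f j) (f k)" if "i \<in> {1..n}" "j \<in> {1..n}" "k \<in> {1..n}" for i j k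
      using S.K0_multiplier[of "f i" "f j" "f k"] T.K0_multiplier[of i j k] K0 fc sim that by simp
    then show "S.K \<simeq> T.K"
      using S.ring_iso_reindex[OF _ f(1)] by blast
  }
qed

end
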